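(* Let $M$ be a complete locally compact CAT(0)-space and let $X$ be an asymptotic cone of $M$. Let $k\ge1$, let $\gamma$ be a $k$-flat of $M$ (possibly $k=1$), and let $\gamma_\omega$ be its limit in $X$. Suppose that there exists a subgroup $G<\mathrm{Isom}(M)$ that acts cocompactly on $\gamma$. If there is a bi-Lipschitz embedding $\Phi:\mathbb{R}^k\times[0,\infty)\to X$ whose restriction to $\mathbb{R}^k\times\{0\}$ is a homeomorphism onto $\gamma_\omega$, then $\gamma$ bounds a $(k+1)$-dimensional half-flat in $M$.
   Context: Flats and half-flats. A $k$-flat ($k\ge1$) in a CAT(0)-space is an isometrically embedded copy of the standard Euclidean space $\mathbb{R}^k$ (for $k=1$: a bi-infinite geodesic). A $(k+1)$-dimensional half-flat is an isometrically embedded copy of $\mathbb{R}^{k}\times[0,\infty)$. A $k$-flat $\gamma$ bounds a $(k+1)$-dimensional half-flat if there is an isometric embedding of $\mathbb{R}^k\times[0,\infty)$ into the space mapping $\mathbb{R}^k\times\{0\}$ onto $\gamma$. "$G$ acts cocompactly on $\gamma$" means that every element of $G$ leaves $\gamma$ invariant and the quotient $\gamma/G$ is compact. Asymptotic cones. Let $\omega$ be a non-principal ultrafilter on $\mathbb{N}$, let $(M,d,* )$ be a pointed metric space, and let $\lambda_j\in(0,\infty)$ be a sequence of scaling factors with $\omega\lim\lambda_j=\infty$. For sequences $\{x_j\},\{y_j\}$ in $M$ set $d_\omega(\{x_j\},\{y_j\})=\omega\lim d(x_j,y_j)/\lambda_j\in[0,\infty]$. The asymptotic cone $X=\mathrm{Cone}(M)$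 is the set of sequences $\{x_j\}$ with $d_\omega(\{x_j\},\{*\})<\infty$, modulo identifying sequences at $d_\omega$-distance $0$, with metric $d_\omega$. "An asymptotic cone" means one obtained from some choice of basepoint, scaling sequence and ultrafilter. If $M$ is CAT(0), so is $X$. If $\gamma\subset M$ is a $k$-flat, its limit $\gamma_\omega\subset X$ is the set of points of $X$ represented by sequences of points in $\gamma$; it is a $k$-flat of $X$. *)

theory Defs
  imports "HOL-Analysis.Analysis" "HOL-Algebra.Group_Action"
begin

section \<open>Geodesics and CAT(0)-spaces\<close>

definition geodesic :: "(real \<Rightarrow> 'a::metric_space) \<Rightarrow> 'a \<Rightarrow> 'a \<Rightarrow> bool" where
  "geodesic c x y \<longleftrightarrow> c 0 = x \<and> c (dist x y) = y \<and>
     (\<forall>s\<in>{0..dist x y}. \<forall>t\<in>{0..dist x y}. dist (c s) (c t) = \<bar>s - t\<bar>)"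

definition geodesic_segment :: "'a::metric_space set \<Rightarrow> 'a \<Rightarrow> 'a \<Rightarrow> bool" where
  "geodesic_segment S x y \<longleftrightarrow> (\<exists>c. geodesic c x y \<and> S = c ` {0..dist x y})"

text \<open>\<open>u'\<close>, on the Euclidean segment from \<open>x'\<close> to \<open>y'\<close>, is the comparison point of the point
  \<open>u\<close> on the geodesic segment \<open>S\<close> from \<open>x\<close> to \<open>y\<close>.\<close>

definition comparison_point ::
    "'a::metric_space set \<Rightarrow> 'a \<Rightarrow> real^2 \<Rightarrow> real^2 \<Rightarrow> 'a \<Rightarrow> real^2 \<Rightarrow> bool" where
  "comparison_point S x x' y' u u' \<longleftrightarrow>
     u \<in> S \<and> u' \<in> closed_segment x' y' \<and> dist x' u' = dist x u"

text \<open>In the second conjunct \<open>A\<close>, \<open>B\<close>, \<open>C\<close> are the sides of a geodesic triangle with vertices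
  \<open>p\<close>, \<open>q\<close>, \<open>r\<close>, and \<open>p'\<close>, \<open>q'\<close>, \<open>r'\<close> are the vertices of a comparison triangle.\<close>

definition CAT0 :: "'a::metric_space itself \<Rightarrow> bool" where
  "CAT0 _ \<longleftrightarrow>
     (\<forall>x y :: 'a. \<exists>c. geodesic c x y) \<and>
     (\<forall>(p::'a) q r A B C p' q' r' u v u' v'.
        geodesic_segment A p q \<longrightarrow> geodesic_segment B q r \<longrightarrow> geodesic_segment C r p \<longrightarrow>
        dist p' q' = dist p q \<longrightarrow> dist q' r' = dist q r \<longrightarrow> dist r' p' = dist r p \<longrightarrow>
        comparison_point A p p' q' u u' \<or> comparison_point B q q' r' u u' \<or>
          comparison_point C r r' p' u u' \<longrightarrow>
        comparison_point A p p' q' v v' \<or> comparison_point B q q' r' v v' \<or>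
          comparison_point C r r' p' v v' \<longrightarrow>
        dist u v \<le> dist u' v')"

section \<open>Flats and half-flats\<close>

definition isometric_embedding_on ::
    "'a::metric_space set \<Rightarrow> ('a \<Rightarrow> 'b::metric_space) \<Rightarrow> bool" where
  "isometric_embedding_on S f \<longleftrightarrow> (\<forall>x\<in>S. \<forall>y\<in>S. dist (f x) (f y) = dist x y)"

text \<open>The dimension \<open>k\<close> is \<open>CARD('k)\<close>. The metric of \<open>(real^'k) \<times> real\<close> is the Euclidean product
  metric, so \<open>half_space\<close> is \<open>\<real>\<^sup>k \<times> [0,\<infinity>)\<close> with its Euclidean metric.\<close>

definition flat :: "'k::finite itself \<Rightarrow> 'a::metric_space set \<Rightarrow> bool" where
  "flat _ \<gamma> \<longleftrightarrow> (\<exists>f :: real^'k \<Rightarrow> 'a. isometric_embedding_on UNIV f \<and> range f = \<gamma>)"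

definition half_space :: "((real^'k) \<times> real) set" where
  "half_space = UNIV \<times> {0..}"

definition half_space_boundary :: "((real^'k) \<times> real) set" where
  "half_space_boundary = UNIV \<times> {0}"

definition bounds_half_flat :: "'k::finite itself \<Rightarrow> 'a::metric_space set \<Rightarrow> bool" where
  "bounds_half_flat _ \<gamma> \<longleftrightarrow>
     (\<exists>f :: (real^'k) \<times> real \<Rightarrow> 'a.
        isometric_embedding_on half_space f \<and> f ` half_space_boundary = \<gamma>)"

section \<open>Isometry groups and cocompact actions\<close>

definition isometry_group :: "('a::metric_space \<Rightarrow> 'a) monoid" where
  "isometry_group =
     \<lparr>carrier = {g. bij g \<and> isometric_embedding_on UNIV g}, mult = (\<circ>), one = id\<rparr>"

lemma group_isometry_group: "group (isometry_group :: ('a::metric_space \<Rightarrow> 'a) monoid)"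
proof (rule groupI)
  fix g :: "'a \<Rightarrow> 'a" assume "g \<in> carrier isometry_group"
  then have g: "bij g" "\<And>x y. dist (g x) (g y) = dist x y"
    by (auto simp: isometry_group_def isometric_embedding_on_def)
  have "dist (inv_into UNIV g x) (inv_into UNIV g y) = dist x y" for x y
    using g(2)[of "inv_into UNIV g x" "inv_into UNIV g y"] g(1) by (simp add: bij_is_surj surj_f_inv_f)
  moreover have "inv_into UNIV g \<circ> g = id"
    using g(1) by (simp add: bij_is_inj)
  ultimately show "\<exists>h\<in>carrier isometry_group. h \<otimes>\<^bsub>isometry_group\<^esub> g = \<one>\<^bsub>isometry_group\<^esub>"
    using g(1) by (intro bexI[of _ "inv_into UNIV g"])
      (auto simp: isometry_group_def isometric_embedding_on_def bij_imp_bij_inv)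
qed (auto simp: isometry_group_def isometric_embedding_on_def bij_comp o_assoc)

text \<open>The quotient of \<open>\<gamma>\<close> by the action of a set \<open>G\<close> of transformations. The action map expected
  by \<^const>\<open>orbit\<close> and \<^const>\<open>orbits\<close> is the identity, as the group elements are themselves
  transformations.\<close>

definition orbit_space :: "('a::metric_space \<Rightarrow> 'a) set \<Rightarrow> 'a set \<Rightarrow> 'a set topology" where
  "orbit_space G \<gamma> =
     topology (\<lambda>U. U \<subseteq> orbits (isometry_group\<lparr>carrier := G\<rparr>) \<gamma> (\<lambda>g. g) \<and>
       openin (top_of_set \<gamma>) {x\<in>\<gamma>. orbit (isometry_group\<lparr>carrier := G\<rparr>) (\<lambda>g. g) x \<in> U})"

lemma openin_orbit_space:
  "openin (orbit_space G \<gamma>) U \<longleftrightarrow>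
     U \<subseteq> orbits (isometry_group\<lparr>carrier := G\<rparr>) \<gamma> (\<lambda>g. g) \<and>
     openin (top_of_set \<gamma>) {x\<in>\<gamma>. orbit (isometry_group\<lparr>carrier := G\<rparr>) (\<lambda>g. g) x \<in> U}"
proof -
  let ?orb = "orbit (isometry_group\<lparr>carrier := G\<rparr>) (\<lambda>g. g)"
  have inter: "{x\<in>\<gamma>. ?orb x \<in> S \<inter> T} = {x\<in>\<gamma>. ?orb x \<in> S} \<inter> {x\<in>\<gamma>. ?orb x \<in> T}" for S T
    by blast
  have union: "{x\<in>\<gamma>. ?orb x \<in> \<Union>K} = (\<Union>S\<in>K. {x\<in>\<gamma>. ?orb x \<in> S})" for K
    by blast
  have "istopology (\<lambda>U. U \<subseteq> orbits (isometry_group\<lparr>carrier := G\<rparr>) \<gamma> (\<lambda>g. g) \<and>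
          openin (top_of_set \<gamma>) {x\<in>\<gamma>. ?orb x \<in> U})"
    unfolding istopology_def inter union by (blast intro: openin_Int openin_Union)
  then show ?thesis
    by (simp add: orbit_space_def topology_inverse')
qed

lemma quotient_map_orbit_space:
  "quotient_map (top_of_set \<gamma>) (orbit_space G \<gamma>)
     (orbit (isometry_group\<lparr>carrier := G\<rparr>) (\<lambda>g. g))"
proof -
  let ?orb = "orbit (isometry_group\<lparr>carrier := G\<rparr>) (\<lambda>g. g)"
  let ?O = "orbits (isometry_group\<lparr>carrier := G\<rparr>) \<gamma> (\<lambda>g. g)"
  have im: "?O = ?orb ` \<gamma>"
    by (auto simp: orbits_def)
  then have "{x\<in>\<gamma>. ?orb x \<in> ?O} = \<gamma>"
    by auto
  then have "openin (orbit_space G \<gamma>) ?O"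
    by (simp add: openin_orbit_space)
  then have "topspace (orbit_space G \<gamma>) = ?O"
    using openin_topspace[of "orbit_space G \<gamma>", unfolded openin_orbit_space]
    by (intro subset_antisym openin_subset) auto
  then show ?thesis
    by (auto simp: quotient_map_def openin_orbit_space im)
qed

definition acts_cocompactly_on :: "('a::metric_space \<Rightarrow> 'a) set \<Rightarrow> 'a set \<Rightarrow> bool" where
  "acts_cocompactly_on G \<gamma> \<longleftrightarrow> (\<forall>g\<in>G. g ` \<gamma> = \<gamma>) \<and> compact_space (orbit_space G \<gamma>)"

section \<open>Asymptotic cones\<close>

definition nonprincipal_ultrafilter :: "nat filter \<Rightarrow> bool" where
  "nonprincipal_ultrafilter \<omega> \<longleftrightarrow> \<omega> \<noteq> bot \<and>
     (\<forall>P. eventually P \<omega> \<or> eventually (\<lambda>j. \<not> P j) \<omega>) \<and>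
     (\<forall>n. \<not> eventually (\<lambda>j. j = n) \<omega>)"

definition seq_dist ::
    "nat filter \<Rightarrow> (nat \<Rightarrow> real) \<Rightarrow> (nat \<Rightarrow> 'a::metric_space) \<Rightarrow> (nat \<Rightarrow> 'a) \<Rightarrow> ennreal" where
  "seq_dist \<omega> \<rho> x y = Lim \<omega> (\<lambda>j. ennreal (dist (x j) (y j) / \<rho> j))"

definition cone_seqs ::
    "nat filter \<Rightarrow> (nat \<Rightarrow> real) \<Rightarrow> 'a::metric_space \<Rightarrow> (nat \<Rightarrow> 'a) set" where
  "cone_seqs \<omega> \<rho> b = {x. seq_dist \<omega> \<rho> x (\<lambda>_. b) < \<infinity>}"

definition cone_rel ::
    "nat filter \<Rightarrow> (nat \<Rightarrow> real) \<Rightarrow> 'a::metric_space \<Rightarrow> ((nat \<Rightarrow> 'a) \<times> (nat \<Rightarrow> 'a)) set" where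
  "cone_rel \<omega> \<rho> b =
     {(x, y). x \<in> cone_seqs \<omega> \<rho> b \<and> y \<in> cone_seqs \<omega> \<rho> b \<and> seq_dist \<omega> \<rho> x y = 0}"

definition asymptotic_cone ::
    "nat filter \<Rightarrow> (nat \<Rightarrow> real) \<Rightarrow> 'a::metric_space \<Rightarrow> (nat \<Rightarrow> 'a) set set" where
  "asymptotic_cone \<omega> \<rho> b = cone_seqs \<omega> \<rho> b // cone_rel \<omega> \<rho> b"

text \<open>The metric of the cone is \<^const>\<open>seq_dist\<close> of arbitrary representatives. It is written
  as an infimum over all of them, on which nothing depends (see the lemma \<open>cone_dist_eq\<close> below),
  so that it is nonnegative and symmetric even outside \<^term>\<open>asymptotic_cone \<omega> \<rho> b\<close>, as the locale
  \<^locale>\<open>Metric_space\<close> demands.\<close>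

definition cone_dist ::
    "nat filter \<Rightarrow> (nat \<Rightarrow> real) \<Rightarrow> (nat \<Rightarrow> 'a::metric_space) set \<Rightarrow> (nat \<Rightarrow> 'a) set \<Rightarrow> real" where
  "cone_dist \<omega> \<rho> \<xi> \<eta> = enn2real (INF x\<in>\<xi>. INF y\<in>\<eta>. seq_dist \<omega> \<rho> x y)"

definition cone_limit ::
    "nat filter \<Rightarrow> (nat \<Rightarrow> real) \<Rightarrow> 'a::metric_space \<Rightarrow> 'a set \<Rightarrow> (nat \<Rightarrow> 'a) set set" where
  "cone_limit \<omega> \<rho> b \<gamma> = {\<xi>\<in>asymptotic_cone \<omega> \<rho> b. \<exists>x\<in>\<xi>. \<forall>j. x j \<in> \<gamma>}"

text \<open>The lemmas below show that the limit in \<^const>\<open>seq_dist\<close> exists, that its value on a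
  pair of points of the cone does not depend on the choice of representatives, and that
  \<^const>\<open>cone_dist\<close> is a metric on the cone.\<close>

lemma ultrafilter_tendsto_ennreal:
  fixes f :: "nat \<Rightarrow> ennreal"
  assumes "nonprincipal_ultrafilter \<omega>"
  shows "(f \<longlongrightarrow> Lim \<omega> f) \<omega>"
proof -
  have ne: "\<omega> \<noteq> bot" and ultra: "\<And>P. eventually P \<omega> \<or> eventually (\<lambda>j. \<not> P j) \<omega>"
    using assms by (auto simp: nonprincipal_ultrafilter_def)
  have "filtermap f \<omega> \<noteq> bot"
    using ne by (simp add: filtermap_bot_iff)
  then obtain l where l: "inf (nhds l) (filtermap f \<omega>) \<noteq> bot"
    using compact_UNIV[where 'a = ennreal] unfolding compact_filter by auto
  have "(f \<longlongrightarrow> l) \<omega>"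
  proof (rule topological_tendstoI, rule ccontr)
    fix S assume S: "open S" "l \<in> S" and "\<not> (\<forall>\<^sub>F j in \<omega>. f j \<in> S)"
    then have "eventually (\<lambda>y. y \<notin> S) (filtermap f \<omega>)"
      using ultra[of "\<lambda>j. f j \<in> S"] by (simp add: eventually_filtermap)
    moreover have "eventually (\<lambda>y. y \<in> S) (nhds l)"
      using S by (rule eventually_nhds_in_open)
    ultimately have "eventually (\<lambda>_. False) (inf (nhds l) (filtermap f \<omega>))"
      unfolding eventually_inf by (intro exI[of _ "\<lambda>y. y \<in> S"] exI[of _ "\<lambda>y. y \<notin> S"]) auto
    then show False
      using l by (simp add: eventually_False)
  qed
  then show ?thesis
    using tendsto_Lim[OF _ \<open>(f \<longlongrightarrow> l) \<omega>\<close>] ne by simp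
qed

lemma seq_dist_commute: "seq_dist \<omega> \<rho> x y = seq_dist \<omega> \<rho> y x"
  by (simp add: seq_dist_def dist_commute)

context
  fixes \<omega> :: "nat filter" and \<rho> :: "nat \<Rightarrow> real"
  assumes \<omega>: "nonprincipal_ultrafilter \<omega>" and \<rho>: "\<And>j. \<rho> j > 0"
begin

lemma tendsto_seq_dist:
  "((\<lambda>j. ennreal (dist (x j) (y j) / \<rho> j)) \<longlongrightarrow> seq_dist \<omega> \<rho> x y) \<omega>"
  unfolding seq_dist_def by (rule ultrafilter_tendsto_ennreal[OF \<omega>])

lemma seq_dist_refl: "seq_dist \<omega> \<rho> x x = 0"
proof -
  have "\<omega> \<noteq> bot"
    using \<omega> by (simp add: nonprincipal_ultrafilter_def)
  then show ?thesis
    using tendsto_unique[OF _ tendsto_seq_dist[of x x], of 0] by simp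
qed

lemma seq_dist_triangle: "seq_dist \<omega> \<rho> x z \<le> seq_dist \<omega> \<rho> x y + seq_dist \<omega> \<rho> y z"
proof -
  have "ennreal (dist (x j) (z j) / \<rho> j) \<le>
          ennreal (dist (x j) (y j) / \<rho> j) + ennreal (dist (y j) (z j) / \<rho> j)" for j
  proof -
    have "dist (x j) (z j) / \<rho> j \<le> dist (x j) (y j) / \<rho> j + dist (y j) (z j) / \<rho> j"
      using \<rho>[of j] by (simp add: add_divide_distrib[symmetric] divide_right_mono dist_triangle)
    then show ?thesis
      using \<rho>[of j] by (simp flip: ennreal_plus add: ennreal_leI)
  qed
  moreover have "\<omega> \<noteq> bot"
    using \<omega> by (simp add: nonprincipal_ultrafilter_def)
  ultimately show ?thesis
    using tendsto_le[OF _ tendsto_add[OF tendsto_seq_dist[of x y] tendsto_seq_dist[of y z]]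
        tendsto_seq_dist[of x z]] by simp
qed

lemma seq_dist_finite:
  assumes "x \<in> cone_seqs \<omega> \<rho> b" "y \<in> cone_seqs \<omega> \<rho> b"
  shows "seq_dist \<omega> \<rho> x y < \<infinity>"
  using assms seq_dist_triangle[of x y "\<lambda>_. b"] seq_dist_commute[of \<omega> \<rho> y "\<lambda>_. b"]
  by (auto simp: cone_seqs_def ennreal_add_less_top intro: le_less_trans)

lemma equiv_cone_rel: "equiv (cone_seqs \<omega> \<rho> b) (cone_rel \<omega> \<rho> b)"
proof (rule equivI)
  show "trans (cone_rel \<omega> \<rho> b)"
  proof (rule transI)
    fix x y z assume "(x, y) \<in> cone_rel \<omega> \<rho> b" "(y, z) \<in> cone_rel \<omega> \<rho> b"
    then show "(x, z) \<in> cone_rel \<omega> \<rho> b"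
      using seq_dist_triangle[of x z y] by (simp add: cone_rel_def)
  qed
qed (auto simp: cone_rel_def refl_on_def sym_def seq_dist_refl seq_dist_commute)

lemma seq_dist_cong:
  assumes "(x, x') \<in> cone_rel \<omega> \<rho> b" "(y, y') \<in> cone_rel \<omega> \<rho> b"
  shows "seq_dist \<omega> \<rho> x y = seq_dist \<omega> \<rho> x' y'"
proof (rule antisym)
  have z: "seq_dist \<omega> \<rho> x x' = 0" "seq_dist \<omega> \<rho> x' x = 0"
      "seq_dist \<omega> \<rho> y y' = 0" "seq_dist \<omega> \<rho> y' y = 0"
    using assms seq_dist_commute[of \<omega> \<rho> x x'] seq_dist_commute[of \<omega> \<rho> y y']
    by (auto simp: cone_rel_def)
  show "seq_dist \<omega> \<rho> x y \<le> seq_dist \<omega> \<rho> x' y'"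
    using order_trans[OF seq_dist_triangle[of x y x'] add_left_mono[OF seq_dist_triangle[of x' y y']]]
    by (simp add: z)
  show "seq_dist \<omega> \<rho> x' y' \<le> seq_dist \<omega> \<rho> x y"
    using order_trans[OF seq_dist_triangle[of x' y' x] add_left_mono[OF seq_dist_triangle[of x y' y]]]
    by (simp add: z)
qed

lemma cone_dist_eq:
  assumes "\<xi> \<in> asymptotic_cone \<omega> \<rho> b" "\<eta> \<in> asymptotic_cone \<omega> \<rho> b" "x \<in> \<xi>" "y \<in> \<eta>"
  shows "cone_dist \<omega> \<rho> \<xi> \<eta> = enn2real (seq_dist \<omega> \<rho> x y)"
proof -
  have *: "seq_dist \<omega> \<rho> x' y' = seq_dist \<omega> \<rho> x y" if "x' \<in> \<xi>" "y' \<in> \<eta>" for x' y'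
    using quotient_eq_iff[OF equiv_cone_rel[of b]] assms that
    by (intro seq_dist_cong[where b = b]) (auto simp: asymptotic_cone_def)
  have "(INF x\<in>\<xi>. INF y\<in>\<eta>. seq_dist \<omega> \<rho> x y) = seq_dist \<omega> \<rho> x y"
  proof (rule antisym)
    show "(INF x\<in>\<xi>. INF y\<in>\<eta>. seq_dist \<omega> \<rho> x y) \<le> seq_dist \<omega> \<rho> x y"
      using assms(3,4) by (auto intro: INF_lower2)
    show "seq_dist \<omega> \<rho> x y \<le> (INF x\<in>\<xi>. INF y\<in>\<eta>. seq_dist \<omega> \<rho> x y)"
      using * by (simp add: le_INF_iff)
  qed
  then show ?thesis
    by (simp add: cone_dist_def)
qed

lemma cone_rep:
  assumes "\<xi> \<in> asymptotic_cone \<omega> \<rho> b"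
  obtains x where "x \<in> \<xi>" "x \<in> cone_seqs \<omega> \<rho> b"
  using assms in_quotient_imp_non_empty[OF equiv_cone_rel] in_quotient_imp_subset[OF equiv_cone_rel]
  unfolding asymptotic_cone_def by blast

lemma Metric_space_cone: "Metric_space (asymptotic_cone \<omega> \<rho> b) (cone_dist \<omega> \<rho>)"
proof
  show "0 \<le> cone_dist \<omega> \<rho> \<xi> \<eta>" for \<xi> \<eta> :: "(nat \<Rightarrow> 'a) set"
    by (simp add: cone_dist_def)
  show "cone_dist \<omega> \<rho> \<xi> \<eta> = cone_dist \<omega> \<rho> \<eta> \<xi>" for \<xi> \<eta> :: "(nat \<Rightarrow> 'a) set"
    unfolding cone_dist_def by (subst INF_commute) (simp add: seq_dist_commute)
next
  fix \<xi> \<eta> assume \<xi>: "\<xi> \<in> asymptotic_cone \<omega> \<rho> b" and \<eta>: "\<eta> \<in> asymptotic_cone \<omega> \<rho> b"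
  obtain x y where x: "x \<in> \<xi>" "x \<in> cone_seqs \<omega> \<rho> b" and y: "y \<in> \<eta>" "y \<in> cone_seqs \<omega> \<rho> b"
    using cone_rep[OF \<xi>] cone_rep[OF \<eta>] by metis
  have "\<xi> = \<eta> \<longleftrightarrow> (x, y) \<in> cone_rel \<omega> \<rho> b"
    using quotient_eq_iff[OF equiv_cone_rel[of b]] \<xi> \<eta> x y by (auto simp: asymptotic_cone_def)
  also have "\<dots> \<longleftrightarrow> seq_dist \<omega> \<rho> x y = 0"
    using x y by (simp add: cone_rel_def)
  finally show "cone_dist \<omega> \<rho> \<xi> \<eta> = 0 \<longleftrightarrow> \<xi> = \<eta>"
    using cone_dist_eq[OF \<xi> \<eta> x(1) y(1)] seq_dist_finite[OF x(2) y(2)]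
    by (auto simp: enn2real_eq_0_iff)
  fix \<zeta> assume \<zeta>: "\<zeta> \<in> asymptotic_cone \<omega> \<rho> b"
  obtain z where z: "z \<in> \<zeta>" "z \<in> cone_seqs \<omega> \<rho> b"
    using cone_rep[OF \<zeta>] by metis
  have fin: "seq_dist \<omega> \<rho> x y < \<infinity>" "seq_dist \<omega> \<rho> y z < \<infinity>"
    using seq_dist_finite[OF x(2) y(2)] seq_dist_finite[OF y(2) z(2)] by simp_all
  then have "enn2real (seq_dist \<omega> \<rho> x z)
      \<le> enn2real (seq_dist \<omega> \<rho> x y + seq_dist \<omega> \<rho> y z)"
    by (intro enn2real_mono seq_dist_triangle) (simp add: ennreal_add_less_top)
  then show "cone_dist \<omega> \<rho> \<xi> \<zeta> \<le> cone_dist \<omega> \<rho> \<xi> \<eta> + cone_dist \<omega> \<rho> \<eta> \<zeta>"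
    using fin by (simp add: cone_dist_eq[OF \<xi> \<eta> x(1) y(1)] cone_dist_eq[OF \<eta> \<zeta> y(1) z(1)]
        cone_dist_eq[OF \<xi> \<zeta> x(1) z(1)] enn2real_plus)
qed

end

section \<open>Bi-Lipschitz embeddings\<close>

definition bilipschitz_embedding_on ::
    "'a::metric_space set \<Rightarrow> 'b set \<Rightarrow> ('b \<Rightarrow> 'b \<Rightarrow> real) \<Rightarrow> ('a \<Rightarrow> 'b) \<Rightarrow> bool" where
  "bilipschitz_embedding_on S X d f \<longleftrightarrow> f ` S \<subseteq> X \<and>
     (\<exists>L>0. \<forall>x\<in>S. \<forall>y\<in>S. dist x y / L \<le> d (f x) (f y) \<and> d (f x) (f y) \<le> L * dist x y)"

end

theory Submission
  imports Defs
begin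

text \<open>
  Write \<open>\<pi>\<close> for the nearest-point projection onto \<open>\<gamma>\<close> and \<open>H x\<close> for the distance from \<open>x\<close> to \<open>\<gamma>\<close>.
  The proof compares two possibilities for the functions \<open>q \<mapsto> dist x q\<close> on \<open>\<gamma>\<close>, each of which is
  convex with its minimum \<open>H x\<close> at \<open>\<pi> x\<close>.

  \<^emph>\<open>Flat horizons.\<close> Suppose that for all \<open>R\<close>, \<open>\<epsilon>\<close> and \<open>D\<close> some \<open>x\<close> with \<open>H x \<ge> D\<close> satisfies
  \<open>dist x q \<le> H x + \<epsilon>\<close> for all \<open>q \<in> \<gamma>\<close> within \<open>R\<close> of \<open>\<pi> x\<close>. By cocompactness such points \<open>x\<^sub>n\<close>, with
  \<open>R\<close> and \<open>D\<close> tending to infinity and \<open>\<epsilon>\<close> to zero, can be moved so that \<open>\<pi> x\<^sub>n\<close> stays bounded, and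
  the geodesics from the points of \<open>\<gamma>\<close> to \<open>x\<^sub>n\<close> converge to rays. The Busemann function of these rays
  is constant on \<open>\<gamma>\<close>, and the rays then sweep out a half-flat (\<open>half_flat_of_flat_horizons\<close>).

  \<^emph>\<open>Steep directions.\<close> Otherwise convexity yields constants \<open>R\<close>, \<open>D\<close> and \<open>c > 0\<close> such that every \<open>x\<close>
  with \<open>H x \<ge> D\<close> has a unit direction \<open>e\<close> in \<open>\<gamma>\<close> with \<open>dist x (\<pi> x + t e) \<ge> H x + c t\<close> for \<open>t \<ge> R\<close>
  (\<open>steep_direction\<close>). Together with the quadrilateral inequality of CAT(0)-geometry this shows that
  in the cone a point \<open>y\<close> that projects onto the open ray from \<open>\<pi> x\<close> in direction \<open>e\<close> lies at
  distance at least \<open>c H x\<close> from \<open>x\<close>, no matter how short the piece of the ray between the two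
  projections is (\<open>steep_direction_gap\<close>).

  The second possibility contradicts the existence of \<open>\<Phi>\<close> (\<open>no_cone_half_space_if_steep\<close>). The slice
  \<open>u \<mapsto> \<Phi> (u, 1)\<close> stays at distance at least \<open>1 / L\<close> from \<open>\<gamma>\<^sub>\<omega>\<close>, where \<open>L\<close> is a bi-Lipschitz constant,
  and the map \<open>g\<close> that sends \<open>u\<close> to the projection of \<open>\<Phi> (u, 1)\<close> is surjective, because it is at
  bounded distance from the homeomorphism \<open>u \<mapsto> \<Phi> (u, 0)\<close> onto \<open>\<gamma>\<^sub>\<omega>\<close>. Countably many balls of any
  fixed small radius cover \<open>\<real>\<^sup>k\<close>, so by Baire's theorem the image of one of them under \<open>g\<close> has an
  interior point. The \<open>\<Phi>\<close>-images of this ball at height \<open>1\<close> are within less than \<open>c / L\<close> of each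
  other, and yet from the interior point an initial piece of every ray is covered by \<open>g\<close>.
\<close>

section \<open>Metric inequalities in CAT(0)-spaces\<close>

lemma CAT0_ex_between:
  fixes x y :: "'a::metric_space"
  assumes "CAT0 TYPE('a)" "0 \<le> t" "t \<le> 1"
  obtains z where "dist x z = t * dist x y" "dist z y = (1 - t) * dist x y"
proof -
  obtain c where c: "geodesic c x y"
    using assms(1) unfolding CAT0_def by blast
  have tin: "t * dist x y \<in> {0..dist x y}"
    using assms by (auto simp: mult_left_le_one_le)
  have "dist (c 0) (c (t * dist x y)) = \<bar>0 - t * dist x y\<bar>"
      "dist (c (t * dist x y)) (c (dist x y)) = \<bar>t * dist x y - dist x y\<bar>"
    using c tin unfolding geodesic_def by (metis atLeastAtMost_iff order_refl zero_le_dist)+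
  moreover have "dist x y - t * dist x y = (1 - t) * dist x y" by (simp add: algebra_simps)
  ultimately show ?thesis
    using that[of "c (t * dist x y)"] c tin assms unfolding geodesic_def by auto
qed

text \<open>The CAT(0) condition, applied to a vertex of a triangle and a point of the opposite side, bounds
  their distance by the distance in the comparison triangle, which Stewart's theorem computes.
  All metric inequalities below follow from this one.\<close>

lemma CAT0_stewart_geodesic:
  fixes x y0 y1 :: "'a::metric_space"
  assumes cat: "CAT0 TYPE('a)" and c: "geodesic c y0 y1" and t: "0 \<le> t" "t \<le> 1"
  shows "(dist x (c (t * dist y0 y1)))\<^sup>2
    \<le> (1 - t) * (dist x y0)\<^sup>2 + t * (dist x y1)\<^sup>2 - t * (1 - t) * (dist y0 y1)\<^sup>2"
proof (cases "y0 = y1")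
  case True
  then show ?thesis using c by (simp add: geodesic_def algebra_simps)
next
  case False
  define l where "l = dist y0 y1"
  define a where "a = dist x y0"
  define b where "b = dist x y1"
  have l: "l > 0" using False by (simp add: l_def)
  \<comment> \<open>The comparison triangle has its vertices at \<open>(0, 0)\<close>, \<open>(l, 0)\<close> and \<open>(X, Y)\<close>.\<close>
  define X where "X = (a\<^sup>2 + l\<^sup>2 - b\<^sup>2) / (2 * l)"
  have X: "2 * l * X = a\<^sup>2 + l\<^sup>2 - b\<^sup>2" using l by (simp add: X_def)
  have tri: "b \<le> a + l" "a \<le> b + l" "l \<le> a + b"
    unfolding a_def b_def l_def by (metis dist_commute dist_triangle)+
  have "X\<^sup>2 \<le> a\<^sup>2"
  proof -
    have "(a + l)\<^sup>2 - b\<^sup>2 \<ge> 0" "b\<^sup>2 - (a - l)\<^sup>2 \<ge> 0"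
      using tri l abs_le_square_iff[of "a - l" b] power_mono[of b "a+l" 2]
      by (auto simp: b_def)
    then have "2 * l * (a + X) \<ge> 0" "2 * l * (a - X) \<ge> 0"
      using X by (simp_all add: power2_eq_square algebra_simps)
    then have "a + X \<ge> 0" "a - X \<ge> 0"
      using l by (simp_all add: zero_le_mult_iff)
    then show ?thesis by (intro abs_le_square_iff[THEN iffD1]) linarith
  qed
  define Y where "Y = sqrt (a\<^sup>2 - X\<^sup>2)"
  have Y: "Y\<^sup>2 = a\<^sup>2 - X\<^sup>2" using \<open>X\<^sup>2 \<le> a\<^sup>2\<close> by (simp add: Y_def)
  define p' :: "real^2" where "p' = vector [0, 0]"
  define q' :: "real^2" where "q' = vector [l, 0]"
  define r' :: "real^2" where "r' = vector [X, Y]"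
  define u' :: "real^2" where "u' = vector [t * l, 0]"
  have D: "dist (vector [x1, x2] :: real^2) (vector [z1, z2]) = sqrt ((x1 - z1)\<^sup>2 + (x2 - z2)\<^sup>2)"
    for x1 x2 z1 z2 :: real
    by (simp add: dist_vec_def L2_set_def UNIV_2 dist_real_def)
  have pq: "dist p' q' = dist y0 y1" using l by (simp add: p'_def q'_def D l_def)
  have "(l - X)\<^sup>2 + (0 - Y)\<^sup>2 = b\<^sup>2" using X Y by (simp add: power2_eq_square algebra_simps)
  then have "sqrt ((l - X)\<^sup>2 + (0 - Y)\<^sup>2) = b" by (simp only:) (simp add: b_def)
  then have qr: "dist q' r' = dist y1 x"
    unfolding q'_def r'_def D by (simp only: b_def dist_commute)
  have "(X - 0)\<^sup>2 + (Y - 0)\<^sup>2 = a\<^sup>2" using Y by simp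
  then have rp: "dist r' p' = dist x y0"
    by (simp add: p'_def r'_def D a_def)
  obtain cB cC where cB: "geodesic cB y1 x" and cC: "geodesic cC x y0"
    using cat unfolding CAT0_def by metis
  define A where "A = c ` {0..dist y0 y1}"
  define B where "B = cB ` {0..dist y1 x}"
  define C where "C = cC ` {0..dist x y0}"
  have tin: "t * l \<in> {0..l}" using t l by (auto simp: mult_left_le_one_le)
  have u0: "dist y0 (c (t * l)) = t * l"
  proof -
    have "dist (c 0) (c (t * l)) = \<bar>0 - t * l\<bar>"
      using c tin l unfolding geodesic_def l_def by (metis atLeastAtMost_iff order_refl zero_le_dist)
    then show ?thesis using c t l by (simp add: geodesic_def)
  qed
  have cu: "comparison_point A y0 p' q' (c (t * l)) u'"
  proof -
    have "u' = (1 - t) *\<^sub>R p' + t *\<^sub>R q'"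
      by (simp add: u'_def p'_def q'_def vec_eq_iff forall_2)
    then have "u' \<in> closed_segment p' q'" using t by (auto simp: closed_segment_def)
    moreover have "dist p' u' = t * l" using t l by (simp add: p'_def u'_def D)
    ultimately show ?thesis using tin u0 by (auto simp: comparison_point_def A_def l_def)
  qed
  have cv: "comparison_point B y1 q' r' x r'"
    using cB qr by (auto simp: comparison_point_def B_def geodesic_def intro!: image_eqI[of _ _ "dist y1 x"])
  have "geodesic_segment A y0 y1" "geodesic_segment B y1 x" "geodesic_segment C x y0"
    using c cB cC by (auto simp: geodesic_segment_def A_def B_def C_def)
  then have "dist (c (t * l)) x \<le> dist u' r'"
    using cat pq qr rp cu cv unfolding CAT0_def by blast
  then have "(dist x (c (t * l)))\<^sup>2 \<le> (dist u' r')\<^sup>2"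
    by (simp add: dist_commute power_mono)
  also have "\<dots> = (t * l - X)\<^sup>2 + Y\<^sup>2" by (simp add: u'_def r'_def D)
  also have "\<dots> = (t * l)\<^sup>2 - t * (2 * l * X) + a\<^sup>2" using Y by (simp add: power2_eq_square algebra_simps)
  also have "\<dots> = (1 - t) * a\<^sup>2 + t * b\<^sup>2 - t * (1 - t) * l\<^sup>2"
    unfolding X by (simp add: power2_eq_square algebra_simps)
  finally show ?thesis by (simp add: a_def b_def l_def)
qed

text \<open>Geodesics are unique: the inequality for geodesics with \<open>x = z\<close> forces \<open>z\<close> onto the geodesic. This
  form allows \<open>z\<close> to come from a line in a flat.\<close>

lemma CAT0_stewart:
  fixes x y0 y1 z :: "'a::metric_space"
  assumes cat: "CAT0 TYPE('a)" and t: "0 \<le> t" "t \<le> 1"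
    and z: "dist y0 z = t * dist y0 y1" "dist z y1 = (1 - t) * dist y0 y1"
  shows "(dist x z)\<^sup>2
    \<le> (1 - t) * (dist x y0)\<^sup>2 + t * (dist x y1)\<^sup>2 - t * (1 - t) * (dist y0 y1)\<^sup>2"
proof -
  obtain c where c: "geodesic c y0 y1"
    using cat unfolding CAT0_def by blast
  have "(dist z (c (t * dist y0 y1)))\<^sup>2
      \<le> (1 - t) * (dist z y0)\<^sup>2 + t * (dist z y1)\<^sup>2 - t * (1 - t) * (dist y0 y1)\<^sup>2"
    by (rule CAT0_stewart_geodesic[OF cat c t])
  also have "\<dots> = 0"
    unfolding dist_commute[of z y0] z by (simp add: power2_eq_square algebra_simps)
  finally have "z = c (t * dist y0 y1)" by simp
  then show ?thesis using CAT0_stewart_geodesic[OF cat c t, of x] by simp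
qed

text \<open>The term \<open>t * (1 - t) * (dist y0 y1)\<^sup>2\<close> in Stewart's inequality dominates the deficit
  \<open>t * (1 - t) * (dist x y0 - dist x y1)\<^sup>2\<close> in the convexity of the square.\<close>

lemma CAT0_dist_convex:
  fixes x y0 y1 z :: "'a::metric_space"
  assumes cat: "CAT0 TYPE('a)" and t: "0 \<le> t" "t \<le> 1"
    and z: "dist y0 z = t * dist y0 y1" "dist z y1 = (1 - t) * dist y0 y1"
  shows "dist x z \<le> (1 - t) * dist x y0 + t * dist x y1"
proof (rule power2_le_imp_le)
  have "\<bar>dist x y0 - dist x y1\<bar> \<le> dist y0 y1"
    by (metis abs_dist_diff_le dist_commute)
  then have "(dist x y0 - dist x y1)\<^sup>2 \<le> (dist y0 y1)\<^sup>2"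
    by (simp add: abs_le_square_iff[symmetric])
  then have "t * (1 - t) * (dist x y0 - dist x y1)\<^sup>2 \<le> t * (1 - t) * (dist y0 y1)\<^sup>2"
    using t by (intro mult_left_mono) auto
  then show "(dist x z)\<^sup>2 \<le> ((1 - t) * dist x y0 + t * dist x y1)\<^sup>2"
    using CAT0_stewart[OF assms, of x] by (simp add: power2_eq_square algebra_simps)
  show "0 \<le> (1 - t) * dist x y0 + t * dist x y1" using t by simp
qed

text \<open>Two applications of Stewart's inequality, one along each of the two sides at \<open>x\<close>.\<close>

lemma CAT0_contract_to_apex:
  fixes x p q z w :: "'a::metric_space"
  assumes cat: "CAT0 TYPE('a)" and t: "0 \<le> t" "t \<le> 1"
    and z: "dist q z = t * dist q x" "dist z x = (1 - t) * dist q x"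
    and w: "dist p w = t * dist p x" "dist w x = (1 - t) * dist p x"
  shows "dist z w \<le> (1 - t) * dist q p"
proof (rule power2_le_imp_le)
  have 1: "(dist z w)\<^sup>2 \<le> (1 - t) * (dist z p)\<^sup>2 + t * (dist z x)\<^sup>2 - t * (1 - t) * (dist p x)\<^sup>2"
    by (rule CAT0_stewart[OF cat t w])
  have "(dist p z)\<^sup>2 \<le> (1 - t) * (dist p q)\<^sup>2 + t * (dist p x)\<^sup>2 - t * (1 - t) * (dist q x)\<^sup>2"
    by (rule CAT0_stewart[OF cat t z])
  then have 2: "(1 - t) * (dist z p)\<^sup>2
      \<le> (1 - t) * ((1 - t) * (dist q p)\<^sup>2 + t * (dist p x)\<^sup>2 - t * (1 - t) * (dist q x)\<^sup>2)"
    using t by (intro mult_left_mono) (auto simp: dist_commute)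
  show "(dist z w)\<^sup>2 \<le> ((1 - t) * dist q p)\<^sup>2"
    using 1 2 unfolding z(2) by (simp add: power2_eq_square algebra_simps)
  show "0 \<le> (1 - t) * dist q p" using t by simp
qed

text \<open>Reshetnyak's inequality for the diagonals of a quadrilateral. The product
  \<open>dist p q * dist r s\<close>, instead of half the sum of squares, is essential later: there one side
  becomes arbitrarily short while the opposite one does not.\<close>

lemma CAT0_quadrilateral:
  fixes p q r s :: "'a::metric_space"
  assumes cat: "CAT0 TYPE('a)"
  shows "(dist p r)\<^sup>2 + (dist q s)\<^sup>2 \<le> (dist p s)\<^sup>2 + (dist q r)\<^sup>2 + 2 * dist p q * dist r s"
proof (cases "p = q \<or> r = s")
  case True
  then show ?thesis by (auto simp: dist_commute)
next
  case False
  define m where "m = dist p q"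
  define n where "n = dist r s"
  have mn: "m > 0" "n > 0" using False by (auto simp: m_def n_def)
  \<comment> \<open>The point \<open>z\<close> on the diagonal from \<open>q\<close> to \<open>s\<close> divides it in the ratio of the two opposite sides;
    the other diagonal is at most as long as the path through \<open>z\<close>.\<close>
  define t where "t = m / (m + n)"
  have t: "0 \<le> t" "t \<le> 1" "1 - t = n / (m + n)" using mn by (auto simp: t_def field_simps)
  obtain z where z: "dist q z = t * dist q s" "dist z s = (1 - t) * dist q s"
    using CAT0_ex_between[OF cat t(1,2)] by blast
  define A where "A = dist p z"
  define B where "B = dist r z"
  have A: "A\<^sup>2 \<le> (1 - t) * m\<^sup>2 + t * (dist p s)\<^sup>2 - t * (1 - t) * (dist q s)\<^sup>2"
    using CAT0_stewart[OF cat t(1,2) z, of p] by (simp add: A_def m_def)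
  have B: "B\<^sup>2 \<le> (1 - t) * (dist q r)\<^sup>2 + t * n\<^sup>2 - t * (1 - t) * (dist q s)\<^sup>2"
    using CAT0_stewart[OF cat t(1,2) z, of r] by (simp add: B_def n_def dist_commute)
  have "dist p r \<le> A + B"
    unfolding A_def B_def by (metis dist_commute dist_triangle)
  then have "(dist p r)\<^sup>2 \<le> (A + B)\<^sup>2" by (simp add: power_mono)
  then have "m * n * (dist p r)\<^sup>2 \<le> m * n * (A + B)\<^sup>2"
    using mn by (simp add: mult_left_mono)
  also have "\<dots> \<le> n * (m + n) * A\<^sup>2 + m * (m + n) * B\<^sup>2"
    using zero_le_power2[of "n * A - m * B"] by (simp add: power2_eq_square algebra_simps)
  also have "\<dots> \<le> n * (m + n) * ((1 - t) * m\<^sup>2 + t * (dist p s)\<^sup>2 - t * (1 - t) * (dist q s)\<^sup>2)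
      + m * (m + n) * ((1 - t) * (dist q r)\<^sup>2 + t * n\<^sup>2 - t * (1 - t) * (dist q s)\<^sup>2)"
    using A B mn by (intro add_mono mult_left_mono) auto
  also have "\<dots> = m * n * ((dist p s)\<^sup>2 + (dist q r)\<^sup>2 + 2 * m * n - (dist q s)\<^sup>2)"
  proof -
    define l where "l = m + n"
    have l: "m = l * t" "n = l * (1 - t)"
      unfolding t(3) unfolding t_def l_def using mn by simp_all
    show ?thesis unfolding l by (simp add: power2_eq_square algebra_simps)
  qed
  finally have "(dist p r)\<^sup>2 \<le> (dist p s)\<^sup>2 + (dist q r)\<^sup>2 + 2 * m * n - (dist q s)\<^sup>2"
    using mn by (simp add: mult_le_cancel_left_pos)
  then show ?thesis by (simp add: m_def n_def)
qed

section \<open>Nearest points on a flat\<close>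

text \<open>The first variation at the nearest point \<open>p\<close>: the angle there is at least a right one.\<close>

lemma CAT0_nearest_pythagoras:
  fixes f :: "'v::real_normed_vector \<Rightarrow> 'a::metric_space"
  assumes cat: "CAT0 TYPE('a)" and f: "isometric_embedding_on UNIV f"
    and near: "\<And>v. dist x (f p) \<le> dist x (f v)"
  shows "(dist x (f p))\<^sup>2 + (dist p q)\<^sup>2 \<le> (dist x (f q))\<^sup>2"
proof -
  have fd: "dist (f v) (f w) = dist v w" for v w using f by (simp add: isometric_embedding_on_def)
  have *: "(dist x (f p))\<^sup>2 + (1 - t) * (dist p q)\<^sup>2 \<le> (dist x (f q))\<^sup>2" if t: "0 < t" "t < 1" for t
  proof -
    define z where "z = p + t *\<^sub>R (q - p)"
    have "p - z = t *\<^sub>R (p - q)" "z - q = (1 - t) *\<^sub>R (p - q)"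
      by (simp_all add: z_def algebra_simps)
    then have "dist p z = t * dist p q" "dist z q = (1 - t) * dist p q"
      using t by (simp_all add: dist_norm)
    then have "(dist x (f z))\<^sup>2
      \<le> (1 - t) * (dist x (f p))\<^sup>2 + t * (dist x (f q))\<^sup>2 - t * (1 - t) * (dist (f p) (f q))\<^sup>2"
      using t by (intro CAT0_stewart[OF cat]) (auto simp: fd)
    moreover have "(dist x (f p))\<^sup>2 \<le> (dist x (f z))\<^sup>2" using near by (simp add: power_mono)
    ultimately have "(dist x (f p))\<^sup>2
      \<le> (1 - t) * (dist x (f p))\<^sup>2 + t * (dist x (f q))\<^sup>2 - t * (1 - t) * (dist p q)\<^sup>2"
      unfolding fd by linarith
    then have "t * ((dist x (f p))\<^sup>2 + (1 - t) * (dist p q)\<^sup>2) \<le> t * (dist x (f q))\<^sup>2"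
      by (simp add: algebra_simps)
    then show ?thesis using t by simp
  qed
  have "((\<lambda>t. (dist x (f p))\<^sup>2 + (1 - t) * (dist p q)\<^sup>2)
      \<longlongrightarrow> (dist x (f p))\<^sup>2 + (1 - 0) * (dist p q)\<^sup>2) (at_right 0)"
    by (intro tendsto_intros)
  moreover have "eventually (\<lambda>t. (dist x (f p))\<^sup>2 + (1 - t) * (dist p q)\<^sup>2 \<le> (dist x (f q))\<^sup>2) (at_right 0)"
    unfolding eventually_at_right_field using * by (intro exI[of _ 1]) auto
  ultimately have "(dist x (f p))\<^sup>2 + (1 - 0) * (dist p q)\<^sup>2 \<le> (dist x (f q))\<^sup>2"
    by (rule tendsto_upperbound) simp
  then show ?thesis by simp
qed

lemma ex_nearest_on_flat:
  fixes f :: "'v::euclidean_space \<Rightarrow> 'a::metric_space"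
  assumes f: "isometric_embedding_on UNIV f"
  shows "\<exists>p. \<forall>v. dist x (f p) \<le> dist x (f v)"
proof -
  have fd: "dist (f v) (f w) = dist v w" for v w using f by (simp add: isometric_embedding_on_def)
  define R where "R = 2 * dist x (f 0)"
  have "continuous_on UNIV f"
    by (intro continuous_onI) (use fd in \<open>auto intro: less_imp_le\<close>)
  then have "continuous_on (cball 0 R) (\<lambda>v. dist x (f v))"
    by (intro continuous_intros) (auto intro: continuous_on_subset)
  then obtain p where p: "p \<in> cball 0 R" "\<And>v. v \<in> cball 0 R \<Longrightarrow> dist x (f p) \<le> dist x (f v)"
    using continuous_attains_inf[of "cball 0 R" "\<lambda>v. dist x (f v)"] by (auto simp: R_def)
  have "dist x (f p) \<le> dist x (f v)" for v
  proof (cases "v \<in> cball 0 R")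
    case False
    then have "dist (f 0) (f v) > 2 * dist x (f 0)" by (simp add: fd R_def)
    then have "dist x (f 0) \<le> dist x (f v)"
      using dist_triangle3[of "f 0" "f v" x] by simp
    then show ?thesis using p(2)[of 0] by (auto simp: R_def)
  qed (use p in auto)
  then show ?thesis by blast
qed

definition flat_proj :: "('v::euclidean_space \<Rightarrow> 'a::metric_space) \<Rightarrow> 'a \<Rightarrow> 'v" where
  "flat_proj f x = (SOME p. \<forall>v. dist x (f p) \<le> dist x (f v))"

lemma flat_proj_nearest:
  assumes "isometric_embedding_on UNIV f"
  shows "dist x (f (flat_proj f x)) \<le> dist x (f v)"
  using someI_ex[OF ex_nearest_on_flat[OF assms, of x]] unfolding flat_proj_def by blast

lemma flat_proj_on_flat:
  assumes "isometric_embedding_on UNIV f"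
  shows "flat_proj f (f v) = v"
  using flat_proj_nearest[OF assms, of "f v" v] assms
  unfolding isometric_embedding_on_def by (metis UNIV_I dist_eq_0_iff dist_le_zero_iff)

lemma flat_proj_pythagoras:
  fixes f :: "'v::euclidean_space \<Rightarrow> 'a::metric_space"
  assumes "CAT0 TYPE('a)" "isometric_embedding_on UNIV f"
  shows "(dist x (f (flat_proj f x)))\<^sup>2 + (dist (flat_proj f x) v)\<^sup>2 \<le> (dist x (f v))\<^sup>2"
  using CAT0_nearest_pythagoras assms flat_proj_nearest by blast

text \<open>In the quadrilateral with vertices \<open>x\<close>, \<open>y\<close> and their projections the diagonals are bounded below
  by Pythagoras and above by the quadrilateral inequality.\<close>

lemma flat_proj_nonexpansive:
  fixes f :: "'v::euclidean_space \<Rightarrow> 'a::metric_space"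
  assumes cat: "CAT0 TYPE('a)" and f: "isometric_embedding_on UNIV f"
  shows "dist (flat_proj f x) (flat_proj f y) \<le> dist x y"
proof -
  define p where "p = flat_proj f x"
  define q where "q = flat_proj f y"
  have fd: "dist (f p) (f q) = dist p q" using f by (simp add: isometric_embedding_on_def)
  have "(dist x (f p))\<^sup>2 + (dist p q)\<^sup>2 \<le> (dist x (f q))\<^sup>2"
      "(dist y (f q))\<^sup>2 + (dist q p)\<^sup>2 \<le> (dist y (f p))\<^sup>2"
    unfolding p_def q_def by (rule flat_proj_pythagoras[OF cat f])+
  moreover have "(dist x (f q))\<^sup>2 + (dist y (f p))\<^sup>2
      \<le> (dist x (f p))\<^sup>2 + (dist y (f q))\<^sup>2 + 2 * dist x y * dist (f q) (f p)"
    by (rule CAT0_quadrilateral[OF cat])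
  ultimately have "dist p q * dist p q \<le> dist x y * dist p q"
    using fd by (simp add: dist_commute power2_eq_square)
  then show ?thesis
    unfolding p_def[symmetric] q_def[symmetric]
    by (cases "p = q") (auto simp: mult_le_cancel_right dest: leD)
qed

section \<open>The Hopf-Rinow theorem\<close>

text \<open>The Hopf-Rinow theorem. The set of radii \<open>r\<close> for which the ball about \<open>a\<close> is compact is an interval
  that is open by local compactness and closed by completeness; in both cases geodesics
  show that a slightly larger ball lies in a small neighbourhood of a smaller one.\<close>

lemma locally_compact_CAT0_proper:
  fixes a :: "'a::complete_space"
  assumes lc: "locally compact (UNIV :: 'a set)" and cat: "CAT0 TYPE('a)"
  shows "compact (cball a R)"
proof -
  have step: "\<exists>z. dist a z \<le> r \<and> dist z x \<le> d" if "dist a x \<le> r + d" "0 \<le> r" "0 \<le> d" for r d x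
  proof (cases "dist a x \<le> r")
    case True then show ?thesis using that by (intro exI[of _ x]) auto
  next
    case False
    then have t: "0 \<le> r / dist a x" "r / dist a x \<le> 1" "dist a x > 0" using that by (auto simp: divide_le_eq_1)
    obtain z where z: "dist a z = r / dist a x * dist a x" "dist z x = (1 - r / dist a x) * dist a x"
      by (rule CAT0_ex_between[OF cat t(1,2)])
    have "dist a z = r" using z(1) t(3) by simp
    moreover have "(1 - r / dist a x) * dist a x = dist a x - r" using t(3) by (simp add: field_simps)
    ultimately show ?thesis using z(2) that(1) by (intro exI[of _ z]) auto
  qed
  define S where "S = {r. 0 \<le> r \<and> compact (cball a r)}"
  have down: "r' \<in> S" if "r \<in> S" "0 \<le> r'" "r' \<le> r" for r r'
  proof -
    have "cball a r' = cball a r' \<inter> cball a r" using that by auto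
    then show ?thesis using that compact_Int_closed[of "cball a r" "cball a r'"]
      by (auto simp: S_def Int_commute)
  qed
  have up: "\<exists>d>0. r + d \<in> S" if r: "r \<in> S" for r
  proof -
    have "\<exists>U V. open U \<and> compact V \<and> x \<in> U \<and> U \<subseteq> V" for x :: 'a
      using lc unfolding locally_def by (metis UNIV_I open_UNIV subtopology_UNIV open_openin)
    then obtain U V where UV: "\<And>x::'a. open (U x) \<and> compact (V x) \<and> x \<in> U x \<and> U x \<subseteq> V x"
      by metis
    have cr: "compact (cball a r)" "0 \<le> r" using r by (auto simp: S_def)
    obtain T where T: "T \<subseteq> cball a r" "finite T" "cball a r \<subseteq> (\<Union>x\<in>T. U x)"
      by (rule compactE_image[OF cr(1), of "cball a r" U]) (use UV in blast)+
    obtain e where e: "e > 0" "\<And>x y. x \<in> cball a r \<Longrightarrow> dist x y < e \<Longrightarrow> y \<in> (\<Union>x\<in>T. U x)"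
    proof -
      have "open (\<Union>x\<in>T. U x)" using UV by auto
      from compact_subset_open_imp_ball_epsilon_subset[OF cr(1) this T(3)]
      obtain e where "e > 0" "(\<Union>x\<in>cball a r. ball x e) \<subseteq> (\<Union>x\<in>T. U x)" by blast
      then show ?thesis using that[of e] by (metis UN_I mem_ball subsetD)
    qed
    have "cball a (r + e/2) \<subseteq> (\<Union>x\<in>T. V x)"
    proof
      fix x assume "x \<in> cball a (r + e/2)"
      then obtain z where "dist a z \<le> r" "dist z x \<le> e/2"
        using step[of x r "e/2"] cr e(1) by auto
      then show "x \<in> (\<Union>x\<in>T. V x)" using e(1) e(2)[of z x] UV by force
    qed
    moreover have "compact (\<Union>x\<in>T. V x)" using T UV by (intro compact_UN) auto
    ultimately have "compact (cball a (r + e/2))"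
      using compact_Int_closed[of "\<Union>x\<in>T. V x" "cball a (r + e/2)"] by (simp add: Int_absorb1)
    then show ?thesis using e(1) cr by (intro exI[of _ "e/2"]) (auto simp: S_def)
  qed
  have lim: "r \<in> S" if "0 < r" "\<And>r'. 0 \<le> r' \<Longrightarrow> r' < r \<Longrightarrow> r' \<in> S" for r
  proof -
    have "\<exists>K. finite K \<and> cball a r \<subseteq> (\<Union>x\<in>K. ball x e)" if e: "e > 0" for e
    proof -
      define r' where "r' = max 0 (r - e/2)"
      have r': "r' \<in> S" "0 \<le> r'" using \<open>0 < r\<close> that(1) e that by (auto simp: r'_def intro!: \<open>\<And>r'. 0 \<le> r' \<Longrightarrow> r' < r \<Longrightarrow> r' \<in> S\<close>)
      have "compact (cball a r')" using r' by (simp add: S_def)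
      then have "\<forall>e>0. \<exists>K. finite K \<and> cball a r' \<subseteq> (\<Union>x\<in>K. ball x e)"
        by (simp add: compact_eq_totally_bounded)
      then obtain K where K: "finite K" "cball a r' \<subseteq> (\<Union>x\<in>K. ball x (e/2))"
        using e half_gt_zero by blast
      have "cball a r \<subseteq> (\<Union>x\<in>K. ball x e)"
      proof
        fix x assume "x \<in> cball a r"
        then have "dist a x \<le> r' + e/2" by (simp add: r'_def)
        then obtain z where z: "dist a z \<le> r'" "dist z x \<le> e/2"
          using step[of x r' "e/2"] r' e by auto
        then obtain k where "k \<in> K" "dist k z < e/2" using K(2) by auto
        then show "x \<in> (\<Union>x\<in>K. ball x e)"
          using z dist_triangle[of k x z] by (intro UN_I[of k]) auto
      qed
      then show ?thesis using K(1) by blast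
    qed
    then show ?thesis using \<open>0 < r\<close> by (auto simp: S_def compact_eq_totally_bounded complete_eq_closed)
  qed
  have all: "r \<in> S" if "0 \<le> r" for r
  proof (rule ccontr)
    assume nr: "r \<notin> S"
    have 0: "0 \<in> S" by (simp add: S_def)
    have bd: "s \<le> r" if "s \<in> S" for s using down[OF that \<open>0 \<le> r\<close>] nr by fastforce
    have bdd: "bdd_above S" using bd by (auto simp: bdd_above_def)
    define m where "m = Sup S"
    have m: "\<And>s. s \<in> S \<Longrightarrow> s \<le> m" using bdd by (simp add: m_def cSup_upper)
    obtain d where "d > 0" "0 + d \<in> S" using up[OF 0] by blast
    then have "0 < m" using m[of "0 + d"] by simp
    moreover have "r' \<in> S" if "0 \<le> r'" "r' < m" for r'
    proof -
      obtain s where "s \<in> S" "r' < s" using \<open>r' < m\<close> 0 unfolding m_def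
        by (metis bdd empty_iff less_cSup_iff)
      then show ?thesis using down \<open>0 \<le> r'\<close> by auto
    qed
    ultimately have "m \<in> S" by (rule lim)
    then obtain d where "d > 0" "m + d \<in> S" using up by blast
    then show False using m[of "m + d"] by simp
  qed
  show ?thesis
  proof (cases "0 \<le> R")
    case True then show ?thesis using all[of R] by (simp add: S_def)
  next
    case False then show ?thesis by simp
  qed
qed

section \<open>Limits along ultrafilters\<close>

text \<open>A cluster point of a sequence along an ultrafilter is its limit. Limits along \<open>\<omega>\<close> replace
  the extraction of subsequences throughout.\<close>

lemma nonprincipal_ultrafilter_compact_limit:
  assumes \<omega>: "nonprincipal_ultrafilter \<omega>" and K: "compact K" and F: "\<forall>\<^sub>F j in \<omega>. F j \<in> K"
  shows "\<exists>l\<in>K. (F \<longlongrightarrow> l) \<omega>"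
proof -
  have ne: "\<omega> \<noteq> bot" and ultra: "\<And>P. eventually P \<omega> \<or> eventually (\<lambda>j. \<not> P j) \<omega>"
    using \<omega> by (auto simp: nonprincipal_ultrafilter_def)
  have "filtermap F \<omega> \<noteq> bot"
    using ne by (simp add: filtermap_bot_iff)
  moreover have "eventually (\<lambda>x. x \<in> K) (filtermap F \<omega>)"
    using F by (simp add: eventually_filtermap)
  ultimately obtain l where l: "l \<in> K" "inf (nhds l) (filtermap F \<omega>) \<noteq> bot"
    using K unfolding compact_filter by blast
  have "(F \<longlongrightarrow> l) \<omega>"
  proof (rule topological_tendstoI, rule ccontr)
    fix S assume S: "open S" "l \<in> S" and "\<not> (\<forall>\<^sub>F j in \<omega>. F j \<in> S)"
    then have "eventually (\<lambda>y. y \<notin> S) (filtermap F \<omega>)"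
      using ultra[of "\<lambda>j. F j \<in> S"] by (simp add: eventually_filtermap)
    moreover have "eventually (\<lambda>y. y \<in> S) (nhds l)"
      using S by (rule eventually_nhds_in_open)
    ultimately have "eventually (\<lambda>_. False) (inf (nhds l) (filtermap F \<omega>))"
      unfolding eventually_inf by (intro exI[of _ "\<lambda>y. y \<in> S"] exI[of _ "\<lambda>y. y \<notin> S"]) auto
    then show False
      using l by (simp add: eventually_False)
  qed
  then show ?thesis using l by blast
qed

lemma nonprincipal_ultrafilter_le_sequentially:
  assumes "nonprincipal_ultrafilter \<omega>"
  shows "\<omega> \<le> sequentially"
  unfolding le_sequentially
proof
  fix N :: nat
  have "\<forall>\<^sub>F j in \<omega>. j \<noteq> n" for n
    using assms unfolding nonprincipal_ultrafilter_def by metis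
  then have "\<forall>\<^sub>F j in \<omega>. \<forall>n\<in>{..<N}. j \<noteq> n"
    by (intro eventually_ball_finite) auto
  then show "\<forall>\<^sub>F j in \<omega>. N \<le> j"
    by (rule eventually_mono) (auto simp: not_less[symmetric])
qed

section \<open>Half-flats from distant points with flat horizons\<close>

text \<open>The points \<open>x n\<close> converge to a boundary point whose Busemann function is constant on the flat. The
  limits \<open>h v t\<close> of the points at distance \<open>t\<close> from \<open>f v\<close> on the geodesic from \<open>f v\<close> to \<open>x n\<close> form the
  half-flat: \<open>v \<mapsto> h v t\<close> does not expand distances, as geodesics to a common point approach each
  other, while the Busemann function shows that \<open>h v s\<close> is the nearest point to \<open>h v t\<close> on the
  slice at height \<open>s\<close>. So Pythagoras bounds the diagonals of the quadrilaterals
  formed by the points over \<open>v\<close> and \<open>w\<close> at heights \<open>s\<close> and \<open>t\<close> from below, and the quadrilateral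
  inequality leaves no room for anything but Euclidean rectangles.\<close>

lemma half_flat_of_far_points:
  fixes f :: "real^'k::finite \<Rightarrow> 'a::metric_space" and x :: "nat \<Rightarrow> 'a"
  assumes cat: "CAT0 TYPE('a)" and proper: "\<And>(a::'a) R. compact (cball a R)"
    and \<omega>: "nonprincipal_ultrafilter \<omega>" and f: "isometric_embedding_on UNIV f"
    and far: "\<And>n v. H n \<le> dist (x n) (f v)" and H: "filterlim H at_top \<omega>"
    and horizon: "\<And>v. ((\<lambda>n. dist (x n) (f v) - H n) \<longlongrightarrow> 0) \<omega>"
  shows "bounds_half_flat TYPE('k) (range f)"
proof -
  have fd: "dist (f v) (f w) = dist v w" for v w using f by (simp add: isometric_embedding_on_def)
  have ne: "\<omega> \<noteq> bot" using \<omega> by (simp add: nonprincipal_ultrafilter_def)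
  define d where "d n v = dist (f v) (x n)" for n v
  have diff: "((\<lambda>n. d n v - d n w) \<longlongrightarrow> 0) \<omega>" for v w
    using tendsto_diff[OF horizon[of v] horizon[of w]] by (simp add: d_def dist_commute)
  have "\<forall>n v. \<exists>c. geodesic c (f v) (x n)" using cat unfolding CAT0_def by blast
  then obtain c where c: "\<And>n v. geodesic (c n v) (f v) (x n)" by metis
  have cst: "dist (c n v s) (c n v t) = \<bar>s - t\<bar>" if "0 \<le> s" "s \<le> d n v" "0 \<le> t" "t \<le> d n v" for n v s t
    using c[of n v] that by (simp add: geodesic_def d_def)
  have c0: "c n v 0 = f v" and cend: "c n v (d n v) = x n" for n v
    using c[of n v] by (simp_all add: geodesic_def d_def)
  have cx: "dist (c n v t) (x n) = d n v - t" if "0 \<le> t" "t \<le> d n v" for n v t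
    using cst[of t n v "d n v"] that cend[of n v] by (simp add: d_def)
  have cf: "dist (f v) (c n v t) = t" if "0 \<le> t" "t \<le> d n v" for n v t
    using cst[of 0 n v t] that c0[of n v] by (simp add: d_def)
  have big: "\<forall>\<^sub>F n in \<omega>. t \<le> d n v" for t v
    using filterlim_at_top[THEN iffD1, OF H, rule_format, of t]
    by (rule eventually_mono) (use far in \<open>auto simp: d_def dist_commute intro: order_trans\<close>)
  define h where "h v t = Lim \<omega> (\<lambda>n. c n v t)" for v t
  have h: "((\<lambda>n. c n v t) \<longlongrightarrow> h v t) \<omega>" if "0 \<le> t" for v t
  proof -
    have "\<forall>\<^sub>F n in \<omega>. c n v t \<in> cball (f v) t"
      using big[of t v] by (rule eventually_mono) (simp add: cf that)
    from nonprincipal_ultrafilter_compact_limit[OF \<omega> proper this]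
    obtain l where "((\<lambda>n. c n v t) \<longlongrightarrow> l) \<omega>" by blast
    then show ?thesis using tendsto_Lim[OF ne] by (metis h_def)
  qed
  have hd: "((\<lambda>n. dist (c n v s) (c n w t)) \<longlongrightarrow> dist (h v s) (h w t)) \<omega>" if "0 \<le> s" "0 \<le> t" for v w s t
    using that by (intro tendsto_dist h)
  have vert: "dist (h v s) (h v t) = \<bar>s - t\<bar>" if "0 \<le> s" "0 \<le> t" for v s t
  proof -
    have "\<forall>\<^sub>F n in \<omega>. dist (c n v s) (c n v t) = \<bar>s - t\<bar>"
      using big[of s v] big[of t v] by eventually_elim (use that cst in auto)
    then show ?thesis using tendsto_unique[OF ne hd[OF that]] tendsto_eventually by metis
  qed
  have h0: "h v 0 = f v" for v
    using tendsto_unique[OF ne h[of 0 v]] by (simp add: c0)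
  \<comment> \<open>The Busemann function, the limit of \<open>dist z (x n) - H n\<close>, equals \<open>- t\<close> at \<open>h v t\<close> and is
    nonexpansive.\<close>
  have low': "t - s \<le> dist (h v s) (h w t)" if "0 \<le> s" "0 \<le> t" for v w s t
  proof (rule tendsto_le[OF ne hd[OF that]])
    show "((\<lambda>n. (t - s) + (d n v - d n w)) \<longlongrightarrow> t - s) \<omega>"
      using tendsto_add[OF tendsto_const diff[of v w], of "t - s"] by simp
    show "\<forall>\<^sub>F n in \<omega>. (t - s) + (d n v - d n w) \<le> dist (c n v s) (c n w t)"
      using big[of s v] big[of t w]
    proof eventually_elim
      case (elim n)
      then show ?case using cx[of s n v] cx[of t n w] that dist_triangle[of "c n v s" "x n" "c n w t"] by simp
    qed
  qed
  have low: "\<bar>s - t\<bar> \<le> dist (h v s) (h w t)" if "0 \<le> s" "0 \<le> t" for v w s t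
    using low'[OF that, of v w] low'[OF that(2,1), of w v] by (simp add: dist_commute)
  have horiz_le: "dist (h v t) (h w t) \<le> dist v w" if "0 \<le> t" for v w t
  proof (rule tendsto_le[OF ne _ hd[OF that that]])
    show "((\<lambda>n. dist v w + \<bar>d n v - d n w\<bar>) \<longlongrightarrow> dist v w) \<omega>"
      using tendsto_add[OF tendsto_const tendsto_rabs_zero[OF diff[of v w]], of "dist v w"] by simp
    show "\<forall>\<^sub>F n in \<omega>. dist (c n v t) (c n w t) \<le> dist v w + \<bar>d n v - d n w\<bar>"
      using big[of t v] big[of t w] big[of 1 v]
    proof eventually_elim
      case (elim n)
      \<comment> \<open>On the geodesic from \<open>f w\<close> the point at the same fraction \<open>r\<close> of the length is used first; it
        differs from \<open>c n w t\<close> by at most the difference of the two lengths.\<close>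
      define r where "r = t / d n v"
      have r: "0 \<le> r" "r \<le> 1" "r * d n v = t" using elim that by (auto simp: r_def)
      have rw: "0 \<le> r * d n w" "r * d n w \<le> d n w" using r by (auto simp: d_def mult_left_le_one_le)
      have "dist (c n v t) (c n w (r * d n w)) \<le> (1 - r) * dist (f v) (f w)"
      proof (rule CAT0_contract_to_apex[OF cat r(1,2), where x = "x n"])
        show "dist (f v) (c n v t) = r * dist (f v) (x n)"
          using cf[of t n v] that elim r(3) by (simp add: d_def)
        show "dist (c n v t) (x n) = (1 - r) * dist (f v) (x n)"
          using cx[of t n v] that elim r(3) by (simp add: d_def algebra_simps)
        show "dist (f w) (c n w (r * d n w)) = r * dist (f w) (x n)"
          using cf[OF rw] by (simp add: d_def)
        show "dist (c n w (r * d n w)) (x n) = (1 - r) * dist (f w) (x n)"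
          using cx[OF rw] by (simp add: d_def algebra_simps)
      qed
      also have "\<dots> \<le> dist v w" using r by (simp add: fd mult_left_le_one_le)
      finally have 1: "dist (c n v t) (c n w (r * d n w)) \<le> dist v w" .
      have "dist (c n w (r * d n w)) (c n w t) = \<bar>r * d n w - r * d n v\<bar>"
        using cst[of "r * d n w" n w t] rw that elim r(3) by simp
      also have "\<dots> = r * \<bar>d n v - d n w\<bar>" using r(1) by (simp add: right_diff_distrib[symmetric] abs_mult abs_minus_commute)
      also have "\<dots> \<le> \<bar>d n v - d n w\<bar>" using r by (simp add: mult_left_le_one_le)
      finally show ?case using 1 dist_triangle[of "c n v t" "c n w t" "c n w (r * d n w)"] by linarith
    qed
  qed
  \<comment> \<open>The case of the slice at height \<open>0\<close>, which is known to be isometric, comes first. It shows that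
    every slice is isometric, so that Pythagoras also holds for the others.\<close>
  have horiz: "dist (h v t) (h w t) = dist v w" if t: "0 \<le> t" for v w t
  proof (rule antisym[OF horiz_le[OF t]])
    have 1: "t\<^sup>2 + (dist v w)\<^sup>2 \<le> (dist (h v t) (f w))\<^sup>2" for v w
      using CAT0_nearest_pythagoras[OF cat f, of "h v t" v w] low[OF t, of 0 v] vert[OF t, of 0 v] t
      by (simp add: h0)
    have "(dist (f v) (h w t))\<^sup>2 + (dist (h v t) (f w))\<^sup>2
        \<le> (dist (f v) (f w))\<^sup>2 + (dist (h v t) (h w t))\<^sup>2 + 2 * dist (f v) (h v t) * dist (h w t) (f w)"
      by (rule CAT0_quadrilateral[OF cat])
    then have "(dist v w)\<^sup>2 \<le> (dist (h v t) (h w t))\<^sup>2"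
      using 1[of v w] 1[of w v] vert[of 0 t v] vert[of t 0 w] t
      by (simp add: h0 fd dist_commute power2_eq_square)
    then show "dist v w \<le> dist (h v t) (h w t)" by (rule power2_le_imp_le) simp
  qed
  have "(dist (h v s) (h w t))\<^sup>2 = (dist v w)\<^sup>2 + (s - t)\<^sup>2" if st: "0 \<le> s" "0 \<le> t" for v w s t
  proof -
    have 1: "(s - t)\<^sup>2 + (dist v w)\<^sup>2 \<le> (dist (h v t) (h w s))\<^sup>2" if "0 \<le> s" "0 \<le> t" for v w s t
    proof -
      have "isometric_embedding_on UNIV (\<lambda>v. h v s)"
        using horiz[OF that(1)] by (simp add: isometric_embedding_on_def)
      then have "(dist (h v t) (h v s))\<^sup>2 + (dist v w)\<^sup>2 \<le> (dist (h v t) (h w s))\<^sup>2"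
        by (rule CAT0_nearest_pythagoras[OF cat]) (use low[OF that(2,1)] vert[OF that(2,1)] in auto)
      then show ?thesis using vert[OF that(2,1)] by (simp add: power2_commute)
    qed
    have "(dist (h v s) (h w t))\<^sup>2 + (dist (h v t) (h w s))\<^sup>2
        \<le> (dist (h v s) (h w s))\<^sup>2 + (dist (h v t) (h w t))\<^sup>2 + 2 * dist (h v s) (h v t) * dist (h w t) (h w s)"
      by (rule CAT0_quadrilateral[OF cat])
    also have "\<dots> = 2 * (dist v w)\<^sup>2 + 2 * (s - t)\<^sup>2"
      using st by (simp add: horiz vert abs_minus_commute[of t s] flip: power2_eq_square)
    finally show ?thesis
      using 1[OF st, of v w] 1[OF st(2,1), of v w] by (simp add: power2_commute)
  qed
  then have iso: "dist (h v s) (h w t) = dist (v, s) (w, t)" if "0 \<le> s" "0 \<le> t" for v w s t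
    unfolding dist_Pair_Pair dist_real_def power2_abs
    by (rule real_sqrt_unique[symmetric]) (use that in auto)
  show ?thesis
    unfolding bounds_half_flat_def
  proof (intro exI conjI)
    show "isometric_embedding_on half_space (\<lambda>(v, t). h v t)"
      by (auto simp: isometric_embedding_on_def half_space_def iso)
    show "(\<lambda>(v, t). h v t) ` half_space_boundary = range f"
      by (force simp: half_space_boundary_def h0)
  qed
qed

text \<open>The sets of orbits that meet the ball of radius \<open>n\<close> about \<open>a\<close> are open and exhaust the compact
  quotient.\<close>

lemma cocompact_orbits_meet_ball:
  fixes \<gamma> :: "'a::metric_space set"
  assumes G: "subgroup G isometry_group" and co: "acts_cocompactly_on G \<gamma>"
  obtains R where "\<And>p. p \<in> \<gamma> \<Longrightarrow> \<exists>g\<in>G. dist (g p) a \<le> R"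
proof -
  let ?orb = "orbit (isometry_group\<lparr>carrier := G\<rparr>) (\<lambda>g. g)"
  have orb: "?orb x = {g x |g. g \<in> G}" for x by (simp add: orbit_def)
  have cont: "continuous_on UNIV g" if "g \<in> G" for g
  proof -
    have "g \<in> carrier isometry_group" using G that subgroup.subset by blast
    then show ?thesis
      by (intro continuous_onI) (auto simp: isometry_group_def isometric_embedding_on_def intro: less_imp_le)
  qed
  have top: "topspace (orbit_space G \<gamma>) = ?orb ` \<gamma>"
    using quotient_imp_surjective_map[OF quotient_map_orbit_space[of \<gamma> G]] by simp
  define U where "U n = {Q \<in> ?orb ` \<gamma>. \<exists>y\<in>Q. dist y a < real n}" for n
  have "openin (orbit_space G \<gamma>) (U n)" for n
    unfolding openin_orbit_space
  proof
    show "U n \<subseteq> orbits (isometry_group\<lparr>carrier := G\<rparr>) \<gamma> (\<lambda>g. g)"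
      by (auto simp: U_def orbits_def)
    have "open {x. dist (g x) a < real n}" if "g \<in> G" for g
      by (intro open_Collect_less continuous_intros) (use cont[OF that] in auto)
    then have "open (\<Union>g\<in>G. {x. dist (g x) a < real n})" by auto
    moreover have "{x\<in>\<gamma>. ?orb x \<in> U n} = \<gamma> \<inter> (\<Union>g\<in>G. {x. dist (g x) a < real n})"
      unfolding U_def by (auto simp: orb)
    ultimately show "openin (top_of_set \<gamma>) {x\<in>\<gamma>. ?orb x \<in> U n}" by (auto simp: openin_open)
  qed
  moreover have "topspace (orbit_space G \<gamma>) \<subseteq> \<Union>(range U)"
  proof
    fix Q assume Q: "Q \<in> topspace (orbit_space G \<gamma>)"
    then obtain x where x: "x \<in> \<gamma>" "Q = ?orb x" by (auto simp: top)
    have "id \<in> G" using subgroup.one_closed[OF G] by (simp add: isometry_group_def)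
    then have "x \<in> Q" using x by (auto simp: orb intro!: exI[of _ id])
    moreover obtain n where "dist x a < real n" using reals_Archimedean2 by blast
    ultimately show "Q \<in> \<Union>(range U)" using Q by (auto simp: U_def top)
  qed
  ultimately obtain F where F: "finite F" "F \<subseteq> range U" "topspace (orbit_space G \<gamma>) \<subseteq> \<Union>F"
    using co unfolding acts_cocompactly_on_def compact_space_alt by (metis (no_types, lifting) imageE)
  then obtain N where N: "finite N" "F = U ` N" by (meson finite_subset_image)
  have "\<exists>g\<in>G. dist (g p) a \<le> real (Max N)" if "p \<in> \<gamma>" for p
  proof -
    have "?orb p \<in> \<Union>F" using F(3) that by (auto simp: top)
    then obtain n where n: "n \<in> N" "?orb p \<in> U n" using N by auto
    then obtain g where "g \<in> G" "dist (g p) a < real n" by (auto simp: U_def orb)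
    moreover have "n \<le> Max N" using n N by simp
    ultimately show ?thesis by (intro bexI[of _ g]) auto
  qed
  then show ?thesis by (rule that)
qed

text \<open>The group moves the projections of the chosen points into a fixed ball; distances to the flat are
  unchanged because the group preserves it. The bound on a ball of radius \<open>n\<close> about the projection then
  covers any given point of the flat for large \<open>n\<close>.\<close>

lemma half_flat_of_flat_horizons:
  fixes f :: "real^'k::finite \<Rightarrow> 'a::metric_space"
  assumes cat: "CAT0 TYPE('a)" and proper: "\<And>(a::'a) R. compact (cball a R)"
    and \<omega>: "nonprincipal_ultrafilter \<omega>" and f: "isometric_embedding_on UNIV f"
    and G: "subgroup G isometry_group" and co: "acts_cocompactly_on G (range f)"
    and horizon: "\<And>R \<epsilon> D. \<epsilon> > 0 \<Longrightarrow> \<exists>x. D \<le> dist x (f (flat_proj f x)) \<and>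
      (\<forall>v. dist (flat_proj f x) v \<le> R \<longrightarrow> dist x (f v) \<le> dist x (f (flat_proj f x)) + \<epsilon>)"
  shows "bounds_half_flat TYPE('k) (range f)"
proof -
  have fd: "dist (f v) (f w) = dist v w" for v w using f by (simp add: isometric_embedding_on_def)
  obtain B where B: "\<And>p. p \<in> range f \<Longrightarrow> \<exists>g\<in>G. dist (g p) (f 0) \<le> B"
    using cocompact_orbits_meet_ball[OF G co] by blast
  have "\<forall>n. \<exists>x. real n \<le> dist x (f (flat_proj f x)) \<and>
      (\<forall>v. dist (flat_proj f x) v \<le> real n \<longrightarrow> dist x (f v) \<le> dist x (f (flat_proj f x)) + 1 / real (Suc n))"
    using horizon by (intro allI) auto
  then obtain y where y: "\<And>n. real n \<le> dist (y n) (f (flat_proj f (y n)))"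
      "\<And>n v. dist (flat_proj f (y n)) v \<le> real n \<Longrightarrow>
        dist (y n) (f v) \<le> dist (y n) (f (flat_proj f (y n))) + 1 / real (Suc n)"
    by metis
  define p where "p n = flat_proj f (y n)" for n
  have "\<forall>n. \<exists>g\<in>G. dist (g (f (p n))) (f 0) \<le> B" using B by blast
  then obtain g where g: "\<And>n. g n \<in> G" "\<And>n. dist (g n (f (p n))) (f 0) \<le> B" by metis
  have gd: "dist (g n a) (g n b) = dist a b" for n a b
  proof -
    have "g n \<in> carrier isometry_group" using G g(1) subgroup.subset by blast
    then show ?thesis by (auto simp: isometry_group_def isometric_embedding_on_def)
  qed
  have "\<exists>w. f v = g n (f w)" for n v
  proof -
    have "g n ` range f = range f" using co g(1) by (auto simp: acts_cocompactly_on_def)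
    then show ?thesis by (metis (no_types, lifting) imageE rangeI)
  qed
  then have ex: "\<exists>w. f v = g n (f w)" for n v .
  define w where "w n v = (SOME w. f v = g n (f w))" for n v
  have w: "f v = g n (f (w n v))" for n v unfolding w_def by (rule someI_ex[OF ex])
  define H where "H n = dist (y n) (f (p n))" for n
  have dxy: "dist (g n (y n)) (f v) = dist (y n) (f (w n v))" for n v
    using w[where n = n and v = v] gd by metis
  have far: "H n \<le> dist (g n (y n)) (f v)" for n v
    using flat_proj_nearest[OF f] by (simp add: dxy H_def p_def)
  have seq: "\<omega> \<le> sequentially" by (rule nonprincipal_ultrafilter_le_sequentially[OF \<omega>])
  show ?thesis
  proof (rule half_flat_of_far_points[OF cat proper \<omega> f far])
    have "filterlim H at_top sequentially"
      by (rule filterlim_at_top_mono[OF filterlim_real_sequentially]) (simp add: H_def p_def y(1))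
    then show "filterlim H at_top \<omega>" using seq by (rule filterlim_mono[OF _ order_refl])
  next
    fix v
    have "(\<lambda>n. dist (g n (y n)) (f v) - H n) \<longlonglongrightarrow> 0"
    proof (rule tendsto_sandwich[OF _ _ tendsto_const LIMSEQ_inverse_real_of_nat])
      show "\<forall>\<^sub>F n in sequentially. 0 \<le> dist (g n (y n)) (f v) - H n" using far by simp
      have "\<forall>\<^sub>F n in sequentially. B + norm v \<le> real n"
        using filterlim_at_top[THEN iffD1, OF filterlim_real_sequentially] by blast
      then show "\<forall>\<^sub>F n in sequentially. dist (g n (y n)) (f v) - H n \<le> inverse (real (Suc n))"
      proof eventually_elim
        case (elim n)
        have "dist (p n) (w n v) = dist (g n (f (p n))) (f v)" by (metis fd gd w)
        also have "\<dots> \<le> B + norm v"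
          using g(2)[of n] dist_triangle[of "g n (f (p n))" "f v" "f 0"] by (simp add: fd)
        finally have "dist (p n) (w n v) \<le> real n" using elim by simp
        then show ?case using y(2)[of n "w n v"] by (simp add: dxy H_def p_def inverse_eq_divide)
      qed
    qed
    then show "((\<lambda>n. dist (g n (y n)) (f v) - H n) \<longlongrightarrow> 0) \<omega>" by (rule tendsto_mono[OF seq])
  qed
qed

section \<open>Steep directions\<close>

text \<open>A rise by \<open>\<epsilon>\<close> at \<open>v\<close> propagates along the ray from \<open>p\<close> through \<open>v\<close> by convexity of the distance to
  \<open>x\<close>. In the use made of it, \<open>p\<close> is the projection of \<open>x\<close>.\<close>

lemma steep_direction:
  fixes f :: "'v::euclidean_space \<Rightarrow> 'a::metric_space"
  assumes cat: "CAT0 TYPE('a)" and f: "isometric_embedding_on UNIV f"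
    and \<epsilon>: "\<epsilon> > 0" and v: "dist p v \<le> R" "dist x (f p) + \<epsilon> < dist x (f v)"
  shows "\<exists>e. norm e = 1 \<and> (\<forall>t\<ge>R. dist x (f p) + \<epsilon> / R * t \<le> dist x (f (p + t *\<^sub>R e)))"
proof -
  define T where "T = dist p v"
  have "p \<noteq> v" using v(2) \<epsilon> by auto
  then have T: "0 < T" "T \<le> R" using v(1) by (auto simp: T_def)
  define e where "e = (v - p) /\<^sub>R T"
  have e: "norm e = 1" and v_eq: "v = p + T *\<^sub>R e"
    using T by (auto simp: e_def T_def dist_norm norm_minus_commute)
  have "dist x (f p) + \<epsilon> / R * t \<le> dist x (f (p + t *\<^sub>R e))" if t: "R \<le> t" for t
  proof -
    define s where "s = T / t"
    have s: "0 < s" "s \<le> 1" "s * t = T" using T t by (auto simp: s_def)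
    have d: "dist (f (p + a *\<^sub>R e)) (f (p + b *\<^sub>R e)) = \<bar>a - b\<bar>" for a b
      using f e by (simp add: isometric_embedding_on_def dist_norm flip: scaleR_diff_left)
    have "dist x (f v) \<le> (1 - s) * dist x (f p) + s * dist x (f (p + t *\<^sub>R e))"
    proof (rule CAT0_dist_convex[OF cat])
      show "dist (f p) (f v) = s * dist (f p) (f (p + t *\<^sub>R e))"
        using d[of 0 T] d[of 0 t] T t s by (simp add: v_eq)
      show "dist (f v) (f (p + t *\<^sub>R e)) = (1 - s) * dist (f p) (f (p + t *\<^sub>R e))"
        using d[of T t] d[of 0 t] T t s by (simp add: v_eq algebra_simps)
    qed (use s in auto)
    then have "\<epsilon> \<le> s * (dist x (f (p + t *\<^sub>R e)) - dist x (f p))"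
      using v(2) by (simp add: algebra_simps)
    then have "\<epsilon> / s \<le> dist x (f (p + t *\<^sub>R e)) - dist x (f p)"
      using s(1) by (simp add: divide_le_eq mult.commute)
    moreover have "\<epsilon> / R * t \<le> \<epsilon> / s"
      using T t \<epsilon> by (simp add: s_def frac_le)
    ultimately show ?thesis by linarith
  qed
  then show ?thesis using e by blast
qed

lemma flat_proj_quadrilateral:
  fixes f :: "'v::euclidean_space \<Rightarrow> 'a::metric_space"
  assumes cat: "CAT0 TYPE('a)" and f: "isometric_embedding_on UNIV f"
  shows "(dist x (f (flat_proj f y)))\<^sup>2 + (dist (flat_proj f x) (flat_proj f y))\<^sup>2
    \<le> (dist x (f (flat_proj f x)))\<^sup>2 + 2 * dist (flat_proj f x) (flat_proj f y) * dist x y"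
proof -
  define p where "p = flat_proj f x"
  define q where "q = flat_proj f y"
  have "(dist y (f q))\<^sup>2 + (dist q p)\<^sup>2 \<le> (dist y (f p))\<^sup>2"
    unfolding q_def by (rule flat_proj_pythagoras[OF cat f])
  moreover have "(dist x (f q))\<^sup>2 + (dist y (f p))\<^sup>2
      \<le> (dist x (f p))\<^sup>2 + (dist y (f q))\<^sup>2 + 2 * dist x y * dist (f q) (f p)"
    by (rule CAT0_quadrilateral[OF cat])
  moreover have "dist (f q) (f p) = dist p q" "dist q p = dist p q"
    using f by (simp_all add: isometric_embedding_on_def dist_commute)
  ultimately show ?thesis unfolding p_def[symmetric] q_def[symmetric] by (simp add: mult_ac)
qed

text \<open>Let \<open>p\<close> and \<open>q\<close> be the projections of \<open>x\<close> and \<open>y\<close> in the limit, at distance \<open>\<tau>\<close>. Steepness makes the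
  diagonal from \<open>x\<close> to \<open>q\<close> at least \<open>h + c * \<tau>\<close>, so that \<open>flat_proj_quadrilateral\<close> becomes
  \<open>(h + c * \<tau>)\<^sup>2 + \<tau>\<^sup>2 \<le> h\<^sup>2 + 2 * \<tau> * d\<close>. The terms linear in \<open>\<tau>\<close> give a bound on \<open>d\<close> that does not
  depend on \<open>\<tau>\<close>.\<close>

lemma steep_direction_gap:
  fixes f :: "'v::euclidean_space \<Rightarrow> 'a::metric_space" and x y :: "nat \<Rightarrow> 'a"
  assumes cat: "CAT0 TYPE('a)" and f: "isometric_embedding_on UNIV f"
    and \<omega>: "\<omega> \<noteq> bot" and \<rho>: "\<And>j. \<rho> j > 0" "filterlim \<rho> at_top \<omega>"
    and P: "((\<lambda>j. flat_proj f (x j) /\<^sub>R \<rho> j) \<longlongrightarrow> P) \<omega>"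
    and Q: "((\<lambda>j. flat_proj f (y j) /\<^sub>R \<rho> j) \<longlongrightarrow> P + \<tau> *\<^sub>R u) \<omega>" and \<tau>: "\<tau> > 0"
    and h: "((\<lambda>j. dist (x j) (f (flat_proj f (x j))) / \<rho> j) \<longlongrightarrow> h) \<omega>" and h0: "h \<ge> 0"
    and d: "((\<lambda>j. dist (x j) (y j) / \<rho> j) \<longlongrightarrow> d) \<omega>"
    and e: "(e \<longlongrightarrow> u) \<omega>" "norm u = 1" and c: "c > 0"
    and steep: "\<forall>\<^sub>F j in \<omega>. \<forall>t\<ge>R. dist (x j) (f (flat_proj f (x j))) + c * t
      \<le> dist (x j) (f (flat_proj f (x j) + t *\<^sub>R e j))"
  shows "c * h \<le> d"
proof -
  have fd: "dist (f v) (f w) = dist v w" for v w using f by (simp add: isometric_embedding_on_def)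
  define p where "p j = flat_proj f (x j)" for j
  define q where "q j = flat_proj f (y j)" for j
  define H where "H j = dist (x j) (f (p j))" for j
  have sc: "dist a b' / \<rho> j = dist (a /\<^sub>R \<rho> j) (b' /\<^sub>R \<rho> j)" for a b' :: 'v and j
    using \<rho>(1)[of j] by (simp add: dist_norm divide_inverse_commute flip: scaleR_diff_right)
  have pq: "((\<lambda>j. dist (p j) (q j) / \<rho> j) \<longlongrightarrow> \<tau>) \<omega>"
  proof -
    have "dist P (P + \<tau> *\<^sub>R u) = \<tau>" using \<tau> e(2) by (simp add: dist_norm)
    then show ?thesis using tendsto_dist[OF P Q] by (simp only: sc p_def q_def)
  qed
  \<comment> \<open>A lower bound for the rescaled distance from \<open>x j\<close> to the projection of \<open>y j\<close>: that projection
    is within \<open>o(\<rho> j)\<close> of the steep ray of \<open>x j\<close>, at distance \<open>\<tau> * \<rho> j\<close> along it.\<close>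
  define a where "a j = H j / \<rho> j + c * \<tau> - dist (q j) (p j + (\<tau> * \<rho> j) *\<^sub>R e j) / \<rho> j" for j
  have a: "(a \<longlongrightarrow> h + c * \<tau>) \<omega>"
  proof -
    have "((\<lambda>j. dist (q j /\<^sub>R \<rho> j) (p j /\<^sub>R \<rho> j + \<tau> *\<^sub>R e j)) \<longlongrightarrow> dist (P + \<tau> *\<^sub>R u) (P + \<tau> *\<^sub>R u)) \<omega>"
      using P Q e(1) unfolding p_def q_def by (intro tendsto_intros)
    moreover have "dist (q j) (p j + (\<tau> * \<rho> j) *\<^sub>R e j) / \<rho> j = dist (q j /\<^sub>R \<rho> j) (p j /\<^sub>R \<rho> j + \<tau> *\<^sub>R e j)" for j
    proof -
      have "inverse (\<rho> j) * (\<tau> * \<rho> j) = \<tau>" using \<rho>(1)[of j] by simp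
      then show ?thesis by (simp only: sc scaleR_add_right scaleR_scaleR)
    qed
    ultimately have "((\<lambda>j. dist (q j) (p j + (\<tau> * \<rho> j) *\<^sub>R e j) / \<rho> j) \<longlongrightarrow> 0) \<omega>" by simp
    then have "(a \<longlongrightarrow> h + c * \<tau> - 0) \<omega>"
      unfolding a_def using h by (intro tendsto_intros) (simp_all add: H_def p_def)
    then show ?thesis by simp
  qed
  have "\<forall>\<^sub>F j in \<omega>. (a j)\<^sup>2 + (dist (p j) (q j) / \<rho> j)\<^sup>2
      \<le> (H j / \<rho> j)\<^sup>2 + 2 * (dist (p j) (q j) / \<rho> j) * (dist (x j) (y j) / \<rho> j)"
  proof -
    have "h + c * \<tau> > 0" using h0 c \<tau> by (simp add: add_nonneg_pos)
    then have "\<forall>\<^sub>F j in \<omega>. a j > 0" by (rule order_tendstoD(1)[OF a])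
    moreover have "\<forall>\<^sub>F j in \<omega>. R / \<tau> \<le> \<rho> j"
      using \<rho>(2) by (simp add: filterlim_at_top)
    ultimately show ?thesis using steep
    proof eventually_elim
      case (elim j)
      define r where "r = \<rho> j"
      have r: "r > 0" using \<rho>(1) by (simp add: r_def)
      have "R \<le> \<tau> * r" using elim(2) \<tau> by (simp add: r_def divide_le_eq mult.commute)
      then have "H j + c * (\<tau> * r) \<le> dist (x j) (f (p j + (\<tau> * r) *\<^sub>R e j))"
        using elim(3) by (simp add: H_def p_def)
      also have "\<dots> \<le> dist (x j) (f (q j)) + dist (q j) (p j + (\<tau> * r) *\<^sub>R e j)"
        using dist_triangle[of "x j" "f (p j + (\<tau> * r) *\<^sub>R e j)" "f (q j)"] by (simp add: fd)
      finally have "a j * r \<le> dist (x j) (f (q j))"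
        using r by (simp add: a_def r_def[symmetric] algebra_simps)
      then have "(a j * r)\<^sup>2 \<le> (dist (x j) (f (q j)))\<^sup>2"
        using elim(1) r by (intro power_mono) auto
      then have "(a j * r)\<^sup>2 + (dist (p j) (q j))\<^sup>2 \<le> (H j)\<^sup>2 + 2 * dist (p j) (q j) * dist (x j) (y j)"
        using flat_proj_quadrilateral[OF cat f, of "x j" "y j"] by (simp add: p_def q_def H_def)
      then have "((a j * r)\<^sup>2 + (dist (p j) (q j))\<^sup>2) / r\<^sup>2 \<le> ((H j)\<^sup>2 + 2 * dist (p j) (q j) * dist (x j) (y j)) / r\<^sup>2"
        using r by (simp add: divide_right_mono)
      then show ?case
        using r by (simp add: r_def[symmetric] add_divide_distrib power_divide power_mult_distrib power2_eq_square)
    qed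
  qed
  then have "(h + c * \<tau>)\<^sup>2 + \<tau>\<^sup>2 \<le> h\<^sup>2 + 2 * \<tau> * d"
    by (rule tendsto_le[OF \<omega>, rotated 2]) (use h in \<open>intro tendsto_intros pq d a; simp add: H_def p_def\<close>)+
  then have "2 * \<tau> * (c * h) + (c * \<tau>)\<^sup>2 + \<tau>\<^sup>2 \<le> 2 * \<tau> * d" by (simp add: power2_eq_square algebra_simps)
  then have "2 * \<tau> * (c * h) \<le> 2 * \<tau> * d"
    using zero_le_power2[of "c * \<tau>"] zero_le_power2[of \<tau>] by linarith
  then show ?thesis using \<tau> by simp
qed

section \<open>Maps of Euclidean space at bounded distance from the identity\<close>

text \<open>A preimage of \<open>y\<close> is a fixed point of \<open>v \<mapsto> y + (v - g v)\<close>, which maps the ball of radius \<open>B\<close> about \<open>y\<close>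
  to itself.\<close>

lemma surj_if_bounded_displacement:
  fixes g :: "'v::euclidean_space \<Rightarrow> 'v"
  assumes g: "continuous_on UNIV g" and B: "\<And>v. dist (g v) v \<le> B"
  shows "surj g"
proof -
  have "\<exists>v\<in>cball y B. g v = y" for y
  proof (rule brouwer_surjective[where S = "{y}"])
    show "cball y B \<noteq> {}" using order_trans[OF zero_le_dist B[of y]] by simp
    show "continuous_on (cball y B) g" using g by (rule continuous_on_subset) simp
    show "a + (z - g z) \<in> cball y B" if "a \<in> {y}" "z \<in> cball y B" for a z
      using that B[of z] by (simp add: dist_norm norm_minus_commute)
  qed auto
  then show ?thesis by (metis surjI)
qed

text \<open>If the compact images of the balls about a countable dense set had empty interior, their
  complements would be dense open sets with empty intersection, contrary to Baire's theorem.\<close>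

lemma surj_small_ball_image_interior:
  fixes g :: "'v::euclidean_space \<Rightarrow> 'v"
  assumes g: "continuous_on UNIV g" "surj g" and r: "r > 0"
  shows "\<exists>u. interior (g ` cball u r) \<noteq> {}"
proof (rule ccontr)
  assume none: "\<nexists>u. interior (g ` cball u r) \<noteq> {}"
  obtain A :: "'v set" where A: "countable A" "\<And>X. open X \<Longrightarrow> X \<noteq> {} \<Longrightarrow> \<exists>a\<in>A. a \<in> X"
    using countable_dense_exists by metis
  define \<G> where "\<G> = (\<lambda>u. - (g ` cball u r)) ` A"
  have "UNIV \<subseteq> closure (\<Inter>\<G>)"
  proof (rule Baire)
    show "countable \<G>" using A(1) by (simp add: \<G>_def)
    fix T assume "T \<in> \<G>"
    then obtain u where T: "T = - (g ` cball u r)" by (auto simp: \<G>_def)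
    have "compact (g ` cball u r)"
      by (intro compact_continuous_image continuous_on_subset[OF g(1)]) auto
    then have "open T" unfolding T by (simp add: compact_imp_closed open_Compl)
    moreover have "closure T = UNIV" unfolding T closure_complement using none by auto
    ultimately show "openin (top_of_set UNIV) T \<and> UNIV \<subseteq> closure T" by simp
  qed simp
  moreover have "\<Inter>\<G> = {}"
  proof -
    have "\<exists>u\<in>A. z \<in> g ` cball u r" for z
    proof -
      obtain v where v: "z = g v" using g(2) by (rule surjE)
      obtain u where "u \<in> A" "u \<in> ball v r" using A(2)[of "ball v r"] r by auto
      then show ?thesis using v by (intro bexI[of _ u]) (auto simp: dist_commute)
    qed
    then show ?thesis by (auto simp: \<G>_def)
  qed
  ultimately show False by simp
qed

section \<open>Representing points of the cone by sequences\<close>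

lemma cone_seqs_iff_bounded:
  fixes x :: "nat \<Rightarrow> 'a::metric_space"
  assumes \<omega>: "nonprincipal_ultrafilter \<omega>" and \<rho>: "\<And>j. \<rho> j > 0"
  shows "x \<in> cone_seqs \<omega> \<rho> b \<longleftrightarrow> (\<exists>C. \<forall>\<^sub>F j in \<omega>. dist (x j) b / \<rho> j \<le> C)"
proof -
  have lim: "((\<lambda>j. ennreal (dist (x j) b / \<rho> j)) \<longlongrightarrow> seq_dist \<omega> \<rho> x (\<lambda>_. b)) \<omega>"
    by (rule tendsto_seq_dist[OF \<omega> \<rho>])
  have ne: "\<omega> \<noteq> bot" using \<omega> by (simp add: nonprincipal_ultrafilter_def)
  show ?thesis
  proof
    assume "x \<in> cone_seqs \<omega> \<rho> b"
    then have "seq_dist \<omega> \<rho> x (\<lambda>_. b) < \<infinity>" by (simp add: cone_seqs_def)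
    then obtain C where C: "seq_dist \<omega> \<rho> x (\<lambda>_. b) < ennreal C" "0 \<le> C"
      by (metis ennreal_Ex_less_of_nat ennreal_of_nat_eq_real_of_nat infinity_ennreal_def of_nat_0_le_iff)
    have "\<forall>\<^sub>F j in \<omega>. ennreal (dist (x j) b / \<rho> j) < ennreal C"
      by (rule order_tendstoD(2)[OF lim C(1)])
    then have "\<forall>\<^sub>F j in \<omega>. dist (x j) b / \<rho> j \<le> C"
      by (rule eventually_mono) (use \<rho> C(2) in \<open>simp add: ennreal_less_iff less_imp_le\<close>)
    then show "\<exists>C. \<forall>\<^sub>F j in \<omega>. dist (x j) b / \<rho> j \<le> C" by blast
  next
    assume "\<exists>C. \<forall>\<^sub>F j in \<omega>. dist (x j) b / \<rho> j \<le> C"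
    then obtain C where "\<forall>\<^sub>F j in \<omega>. dist (x j) b / \<rho> j \<le> C" by blast
    then have "\<forall>\<^sub>F j in \<omega>. ennreal (dist (x j) b / \<rho> j) \<le> ennreal C"
      by (rule eventually_mono) (simp add: ennreal_leI)
    then have "seq_dist \<omega> \<rho> x (\<lambda>_. b) \<le> ennreal C"
      by (rule tendsto_upperbound[OF lim _ ne])
    then show "x \<in> cone_seqs \<omega> \<rho> b"
      using le_less_trans[OF _ ennreal_less_top] by (simp add: cone_seqs_def infinity_ennreal_def)
  qed
qed

lemma cone_point_subset:
  fixes b :: "'a::metric_space"
  assumes "nonprincipal_ultrafilter \<omega>" "\<And>j. \<rho> j > 0" "\<xi> \<in> asymptotic_cone \<omega> \<rho> b"
  shows "\<xi> \<subseteq> cone_seqs \<omega> \<rho> b"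
  using in_quotient_imp_subset[OF equiv_cone_rel[where \<rho> = \<rho>, OF assms(1,2)]] assms(3)
  unfolding asymptotic_cone_def by blast

lemma cone_dist_tendsto:
  fixes b :: "'a::metric_space"
  assumes \<omega>: "nonprincipal_ultrafilter \<omega>" and \<rho>: "\<And>j. \<rho> j > 0"
    and \<xi>: "\<xi> \<in> asymptotic_cone \<omega> \<rho> b" "x \<in> \<xi>" and \<eta>: "\<eta> \<in> asymptotic_cone \<omega> \<rho> b" "y \<in> \<eta>"
  shows "((\<lambda>j. dist (x j) (y j) / \<rho> j) \<longlongrightarrow> cone_dist \<omega> \<rho> \<xi> \<eta>) \<omega>"
proof -
  have "x \<in> cone_seqs \<omega> \<rho> b" "y \<in> cone_seqs \<omega> \<rho> b"
    using cone_point_subset[where \<rho> = \<rho>, OF \<omega> \<rho>] \<xi> \<eta> by blast+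
  then have fin: "seq_dist \<omega> \<rho> x y < \<infinity>" by (rule seq_dist_finite[OF \<omega> \<rho>])
  have cd: "cone_dist \<omega> \<rho> \<xi> \<eta> = enn2real (seq_dist \<omega> \<rho> x y)"
    by (rule cone_dist_eq[OF \<omega> \<rho> \<xi>(1) \<eta>(1) \<xi>(2) \<eta>(2)])
  then have "ennreal (cone_dist \<omega> \<rho> \<xi> \<eta>) = seq_dist \<omega> \<rho> x y" using fin by simp
  then have "((\<lambda>j. ennreal (dist (x j) (y j) / \<rho> j)) \<longlongrightarrow> ennreal (cone_dist \<omega> \<rho> \<xi> \<eta>)) \<omega>"
    using tendsto_seq_dist[OF \<omega> \<rho>, of x y] by simp
  then have "((\<lambda>j. enn2real (ennreal (dist (x j) (y j) / \<rho> j))) \<longlongrightarrow> cone_dist \<omega> \<rho> \<xi> \<eta>) \<omega>"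
    by (rule tendsto_enn2real) (simp add: cd)
  then show ?thesis using \<rho> by (simp add: less_imp_le)
qed

lemma cone_point_of_seq:
  fixes x :: "nat \<Rightarrow> 'a::metric_space"
  assumes \<omega>: "nonprincipal_ultrafilter \<omega>" and \<rho>: "\<And>j. \<rho> j > 0" and x: "x \<in> cone_seqs \<omega> \<rho> b"
  obtains \<xi> where "\<xi> \<in> asymptotic_cone \<omega> \<rho> b" "x \<in> \<xi>"
proof
  show "cone_rel \<omega> \<rho> b `` {x} \<in> asymptotic_cone \<omega> \<rho> b"
    unfolding asymptotic_cone_def using x by (rule quotientI)
  show "x \<in> cone_rel \<omega> \<rho> b `` {x}"
    using equiv_class_self[OF equiv_cone_rel[OF \<omega> \<rho>] x] .
qed

section \<open>Half-spaces in the cone force flat horizons\<close>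

text \<open>The contradiction comes from the slice of the half-space at height \<open>1\<close>. Points of the cone are
  handled through representing sequences, and the projection of the cone onto \<open>\<gamma>\<^sub>\<omega>\<close> through the
  coordinates \<open>P\<close> that it acquires from the parametrization \<open>f\<close> of the flat.\<close>

lemma no_cone_half_space_if_steep:
  fixes f :: "real^'k::finite \<Rightarrow> 'a::metric_space" and \<Phi> :: "(real^'k) \<times> real \<Rightarrow> (nat \<Rightarrow> 'a) set"
  assumes cat: "CAT0 TYPE('a)" and f: "isometric_embedding_on UNIV f"
    and \<omega>: "nonprincipal_ultrafilter \<omega>" and \<rho>: "\<And>j. \<rho> j > 0" "filterlim \<rho> at_top \<omega>"
    and \<Phi>: "bilipschitz_embedding_on half_space (asymptotic_cone \<omega> \<rho> b) (cone_dist \<omega> \<rho>) \<Phi>"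
    and bd: "\<Phi> ` half_space_boundary = cone_limit \<omega> \<rho> b (range f)"
    and c: "c > 0"
    and steep: "\<And>x. D \<le> dist x (f (flat_proj f x)) \<Longrightarrow>
      \<exists>e. norm e = 1 \<and> (\<forall>t\<ge>R. dist x (f (flat_proj f x)) + c * t \<le> dist x (f (flat_proj f x + t *\<^sub>R e)))"
  shows False
proof -
  have fd: "dist (f v) (f w) = dist v w" for v w using f by (simp add: isometric_embedding_on_def)
  have ne: "\<omega> \<noteq> bot" using \<omega> by (simp add: nonprincipal_ultrafilter_def)
  have small: "((\<lambda>j. a / \<rho> j) \<longlongrightarrow> 0) \<omega>" for a :: real
    by (rule real_tendsto_divide_at_top[OF tendsto_const \<rho>(2)])
  let ?X = "asymptotic_cone \<omega> \<rho> b"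
  note seqs_iff = cone_seqs_iff_bounded[where \<rho> = \<rho>, OF \<omega> \<rho>(1)]
  obtain L where L: "L > 0"
      "\<And>z w. z \<in> half_space \<Longrightarrow> w \<in> half_space \<Longrightarrow> dist z w / L \<le> cone_dist \<omega> \<rho> (\<Phi> z) (\<Phi> w)"
      "\<And>z w. z \<in> half_space \<Longrightarrow> w \<in> half_space \<Longrightarrow> cone_dist \<omega> \<rho> (\<Phi> z) (\<Phi> w) \<le> L * dist z w"
    using \<Phi> unfolding bilipschitz_embedding_on_def by blast
  have \<Phi>X: "\<Phi> z \<in> ?X" if "z \<in> half_space" for z
    using \<Phi> that unfolding bilipschitz_embedding_on_def by blast
  define \<Delta> where "\<Delta> z w = cone_dist \<omega> \<rho> (\<Phi> z) (\<Phi> w)" for z w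
  have hs: "(u, 0) \<in> half_space" "(u, 1) \<in> half_space" for u :: "real^'k"
    by (auto simp: half_space_def)
  have "\<exists>x. x \<in> \<Phi> z \<and> (z \<in> half_space_boundary \<longrightarrow> range x \<subseteq> range f)" if z: "z \<in> half_space" for z
  proof (cases "z \<in> half_space_boundary")
    case True
    then have "\<Phi> z \<in> cone_limit \<omega> \<rho> b (range f)" using bd by blast
    then show ?thesis unfolding cone_limit_def by auto
  next
    case False
    then show ?thesis using cone_rep[where \<rho> = \<rho>, OF \<omega> \<rho>(1) \<Phi>X[OF z]] by metis
  qed
  then obtain x where x: "\<And>z. z \<in> half_space \<Longrightarrow> x z \<in> \<Phi> z"
      and xbd: "\<And>z. z \<in> half_space \<Longrightarrow> z \<in> half_space_boundary \<Longrightarrow> range (x z) \<subseteq> range f"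
    by metis
  have xf: "\<exists>v. x (u, 0) j = f v" for u j
    using xbd[OF hs(1), of u] by (auto simp: half_space_boundary_def)
  have xd: "((\<lambda>j. dist (x z j) (x w j) / \<rho> j) \<longlongrightarrow> \<Delta> z w) \<omega>" if "z \<in> half_space" "w \<in> half_space" for z w
    unfolding \<Delta>_def
    by (rule cone_dist_tendsto[where \<rho> = \<rho>, OF \<omega> \<rho>(1) \<Phi>X[OF that(1)] x[OF that(1)] \<Phi>X[OF that(2)] x[OF that(2)]])
  have xb: "\<exists>C. \<forall>\<^sub>F j in \<omega>. dist (x z j) b / \<rho> j \<le> C" if "z \<in> half_space" for z
    using cone_point_subset[where \<rho> = \<rho>, OF \<omega> \<rho>(1) \<Phi>X[OF that]] x[OF that] seqs_iff by blast
  \<comment> \<open>Every point of the limit flat is represented by a boundary point of the half-space.\<close>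
  have onto: "\<exists>w. ((\<lambda>j. dist (f (v j)) (x (w, 0) j) / \<rho> j) \<longlongrightarrow> 0) \<omega>"
    if bdd: "\<forall>\<^sub>F j in \<omega>. dist (f (v j)) b / \<rho> j \<le> C" for v C
  proof -
    have "(\<lambda>j. f (v j)) \<in> cone_seqs \<omega> \<rho> b" using bdd seqs_iff by blast
    then obtain \<xi> where \<xi>: "\<xi> \<in> ?X" "(\<lambda>j. f (v j)) \<in> \<xi>"
      using cone_point_of_seq[where \<rho> = \<rho>, OF \<omega> \<rho>(1)] by blast
    then have "\<xi> \<in> cone_limit \<omega> \<rho> b (range f)" by (force simp: cone_limit_def)
    then obtain w where w: "\<xi> = \<Phi> (w, 0)" using bd by (auto simp: half_space_boundary_def)
    have "((\<lambda>j. dist (f (v j)) (x (w, 0) j) / \<rho> j) \<longlongrightarrow> cone_dist \<omega> \<rho> \<xi> (\<Phi> (w, 0))) \<omega>"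
      by (rule cone_dist_tendsto[where \<rho> = \<rho>, OF \<omega> \<rho>(1) \<xi> \<Phi>X[OF hs(1)] x[OF hs(1)]])
    moreover have "cone_dist \<omega> \<rho> \<xi> (\<Phi> (w, 0)) = 0"
    proof -
      interpret Metric_space ?X "cone_dist \<omega> \<rho>" by (rule Metric_space_cone[where \<rho> = \<rho>, OF \<omega> \<rho>(1)])
      show ?thesis using \<xi>(1) w by simp
    qed
    ultimately show ?thesis by auto
  qed
  define P where "P z = Lim \<omega> (\<lambda>j. flat_proj f (x z j) /\<^sub>R \<rho> j)" for z
  have sc: "dist (a /\<^sub>R \<rho> j) (b' /\<^sub>R \<rho> j) = dist a b' / \<rho> j" for a b' :: "real^'k" and j
    using \<rho>(1)[of j] by (simp add: dist_norm divide_inverse_commute flip: scaleR_diff_right)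
  have one: "\<forall>\<^sub>F j in \<omega>. a / \<rho> j \<le> 1" for a
    using order_tendstoD(2)[OF small[of a], of 1] by (auto elim: eventually_mono)
  \<comment> \<open>The limit exists because the projection is nonexpansive, so that the coordinates stay bounded.\<close>
  have P: "((\<lambda>j. flat_proj f (x z j) /\<^sub>R \<rho> j) \<longlongrightarrow> P z) \<omega>" if z: "z \<in> half_space" for z
  proof -
    obtain C where C: "\<forall>\<^sub>F j in \<omega>. dist (x z j) b / \<rho> j \<le> C" using xb[OF z] by blast
    have "\<forall>\<^sub>F j in \<omega>. flat_proj f (x z j) /\<^sub>R \<rho> j \<in> cball 0 (C + 1)"
      using C one[of "norm (flat_proj f b)"]
    proof eventually_elim
      case (elim j)
      have "norm (flat_proj f (x z j)) \<le> dist (x z j) b + norm (flat_proj f b)"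
        using flat_proj_nonexpansive[OF cat f, of "x z j" b]
          dist_triangle[of "flat_proj f (x z j)" 0 "flat_proj f b"] by simp
      then have "norm (flat_proj f (x z j)) / \<rho> j \<le> (dist (x z j) b + norm (flat_proj f b)) / \<rho> j"
        using \<rho>(1)[of j] by (simp add: divide_right_mono)
      then have "norm (flat_proj f (x z j)) / \<rho> j \<le> C + 1"
        using elim by (simp add: add_divide_distrib)
      then show ?case using \<rho>(1)[of j] by (simp add: divide_inverse_commute)
    qed
    from nonprincipal_ultrafilter_compact_limit[OF \<omega> compact_cball this]
    obtain l where "((\<lambda>j. flat_proj f (x z j) /\<^sub>R \<rho> j) \<longlongrightarrow> l) \<omega>" by blast
    then show ?thesis using tendsto_Lim[OF ne] by (metis P_def)
  qed
  have P_lip: "dist (P z) (P w) \<le> \<Delta> z w" if "z \<in> half_space" "w \<in> half_space" for z w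
    by (rule tendsto_le[OF ne xd[OF that] tendsto_dist[OF P P]])
      (use that \<rho>(1) in \<open>auto simp: sc divide_right_mono less_imp_le flat_proj_nonexpansive[OF cat f]\<close>)
  have P_bd: "dist (P (u, 0)) (P (v, 0)) = \<Delta> (u, 0) (v, 0)" for u v
  proof -
    have "dist (flat_proj f (x (u, 0) j)) (flat_proj f (x (v, 0) j)) = dist (x (u, 0) j) (x (v, 0) j)" for j
      using xf[of u j] xf[of v j] by (auto simp: flat_proj_on_flat[OF f] fd)
    then have "((\<lambda>j. dist (x (u, 0) j) (x (v, 0) j) / \<rho> j) \<longlongrightarrow> dist (P (u, 0)) (P (v, 0))) \<omega>"
      using tendsto_dist[OF P[OF hs(1)[of u]] P[OF hs(1)[of v]]] by (simp add: sc)
    then show ?thesis by (rule tendsto_unique[OF ne _ xd[OF hs(1) hs(1)]])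
  qed
  have P_onto: "\<exists>u. P (u, 0) = v" for v
  proof -
    have "\<forall>\<^sub>F j in \<omega>. dist (f (\<rho> j *\<^sub>R v)) b / \<rho> j \<le> norm v + 1"
      using one[of "dist (f 0) b"]
    proof eventually_elim
      case (elim j)
      have "dist (f (\<rho> j *\<^sub>R v)) b \<le> \<rho> j * norm v + dist (f 0) b"
        using dist_triangle[of "f (\<rho> j *\<^sub>R v)" b "f 0"] \<rho>(1)[of j] by (simp add: fd)
      then have "dist (f (\<rho> j *\<^sub>R v)) b / \<rho> j \<le> (\<rho> j * norm v + dist (f 0) b) / \<rho> j"
        using \<rho>(1)[of j] by (simp add: divide_right_mono)
      also have "\<dots> = norm v + dist (f 0) b / \<rho> j"
        using \<rho>(1)[of j] by (simp add: add_divide_distrib)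
      finally show ?case using elim by linarith
    qed
    from onto[where v = "\<lambda>j. \<rho> j *\<^sub>R v", OF this]
    obtain u where u: "((\<lambda>j. dist (f (\<rho> j *\<^sub>R v)) (x (u, 0) j) / \<rho> j) \<longlongrightarrow> 0) \<omega>" ..
    have "dist (f (\<rho> j *\<^sub>R v)) (x (u, 0) j) / \<rho> j = dist v (flat_proj f (x (u, 0) j) /\<^sub>R \<rho> j)" for j
    proof -
      obtain w where w: "x (u, 0) j = f w" using xf by blast
      have "v = (\<rho> j *\<^sub>R v) /\<^sub>R \<rho> j" using \<rho>(1)[of j] by simp
      then show ?thesis using sc[of j "\<rho> j *\<^sub>R v" w] by (simp add: w flat_proj_on_flat[OF f] fd)
    qed
    then have "((\<lambda>j. dist (f (\<rho> j *\<^sub>R v)) (x (u, 0) j) / \<rho> j) \<longlongrightarrow> dist v (P (u, 0))) \<omega>"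
      using tendsto_dist[OF tendsto_const P[OF hs(1)[of u]], of v] by simp
    then have "dist v (P (u, 0)) = 0" by (rule tendsto_unique[OF ne _ u])
    then show ?thesis by (intro exI[of _ u]) simp
  qed
  define g where "g u = P (u, 1)" for u
  have dP: "dist (u, s) (v, s) = dist u v" for u v :: "real^'k" and s :: real
    by (simp add: dist_Pair_Pair)
  have g_lip: "dist (g u) (g v) \<le> L * dist u v" for u v
    using P_lip[OF hs(2)[of u] hs(2)[of v]] L(3)[OF hs(2)[of u] hs(2)[of v]] by (simp add: g_def \<Delta>_def dP)
  have g_cont: "continuous_on UNIV g"
    by (rule lipschitz_on_continuous_on[of L]) (use L(1) g_lip in \<open>auto simp: lipschitz_on_def\<close>)
  obtain k where k: "\<And>v. P (k v, 0) = v" using P_onto by metis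
  have k_lip: "dist (k v) (k w) \<le> L * dist v w" for v w
    using P_bd[of "k v" "k w"] L(1) L(2)[OF hs(1)[of "k v"] hs(1)[of "k w"]]
    by (simp add: k \<Delta>_def dP divide_le_eq mult.commute)
  have "surj (g \<circ> k)"
  proof (rule surj_if_bounded_displacement)
    have "continuous_on UNIV k"
      by (rule lipschitz_on_continuous_on[of L]) (use L(1) k_lip in \<open>auto simp: lipschitz_on_def\<close>)
    then show "continuous_on UNIV (g \<circ> k)"
      by (rule continuous_on_compose) (rule continuous_on_subset[OF g_cont], simp)
    show "dist ((g \<circ> k) v) v \<le> L" for v
      using P_lip[OF hs(2)[of "k v"] hs(1)[of "k v"]] L(3)[OF hs(2)[of "k v"] hs(1)[of "k v"]]
      by (simp add: g_def k \<Delta>_def dist_Pair_Pair)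
  qed
  then have g_surj: "surj g" unfolding surj_def by auto
  \<comment> \<open>Points at height \<open>1\<close> over a ball of radius \<open>r\<close> are within \<open>L * (2 * r) = c / (2 * L)\<close> of each
    other in the cone, which is less than the gap \<open>c * h\<close> with \<open>h \<ge> 1 / L\<close>.\<close>
  define r where "r = c / (4 * L\<^sup>2)"
  have r: "r > 0" using c L(1) by (simp add: r_def)
  obtain u where "interior (g ` cball u r) \<noteq> {}"
    using surj_small_ball_image_interior[OF g_cont g_surj r] by blast
  then obtain p \<delta> where p: "\<delta> > 0" "cball p \<delta> \<subseteq> g ` cball u r"
    by (metis ex_in_conv mem_interior_cball)
  have "p \<in> cball p \<delta>" using p(1) by simp
  then have "p \<in> g ` cball u r" using p(2) by (rule rev_subsetD)
  then obtain u1 where u1: "u1 \<in> cball u r" "g u1 = p" by (metis imageE)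
  define X where "X = x (u1, 1)"
  define H where "H j = dist (X j) (f (flat_proj f (X j)))" for j
  obtain C where C: "\<forall>\<^sub>F j in \<omega>. dist (X j) b / \<rho> j \<le> C" using xb[OF hs(2)] unfolding X_def by blast
  have "\<forall>\<^sub>F j in \<omega>. dist (f (flat_proj f (X j))) b / \<rho> j \<le> C + 1"
    using C one[of "dist (f (flat_proj f b)) b"]
  proof eventually_elim
    case (elim j)
    have "dist (f (flat_proj f (X j))) b \<le> dist (X j) b + dist (f (flat_proj f b)) b"
      using flat_proj_nonexpansive[OF cat f, of "X j" b]
        dist_triangle[of "f (flat_proj f (X j))" b "f (flat_proj f b)"] by (simp add: fd)
    then have "dist (f (flat_proj f (X j))) b / \<rho> j \<le> (dist (X j) b + dist (f (flat_proj f b)) b) / \<rho> j"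
      using \<rho>(1)[of j] by (simp add: divide_right_mono)
    also have "\<dots> = dist (X j) b / \<rho> j + dist (f (flat_proj f b)) b / \<rho> j"
      by (simp add: add_divide_distrib)
    finally show ?case using elim by linarith
  qed
  from onto[where v = "\<lambda>j. flat_proj f (X j)", OF this]
  obtain w where w: "((\<lambda>j. dist (f (flat_proj f (X j))) (x (w, 0) j) / \<rho> j) \<longlongrightarrow> 0) \<omega>" ..
  \<comment> \<open>The projection of \<open>X\<close> represents the boundary point \<open>\<Phi> (w, 0)\<close>, so the rescaled height of \<open>X\<close>
    converges to a distance that the bi-Lipschitz bound keeps away from zero.\<close>
  define h where "h = \<Delta> (u1, 1) (w, 0)"
  have h: "((\<lambda>j. H j / \<rho> j) \<longlongrightarrow> h) \<omega>"
  proof -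
    have "((\<lambda>j. H j / \<rho> j - dist (X j) (x (w, 0) j) / \<rho> j) \<longlongrightarrow> 0) \<omega>"
    proof (rule tendsto_rabs_zero_cancel, rule tendsto_sandwich[OF _ _ tendsto_const w])
      show "\<forall>\<^sub>F j in \<omega>. \<bar>H j / \<rho> j - dist (X j) (x (w, 0) j) / \<rho> j\<bar>
          \<le> dist (f (flat_proj f (X j))) (x (w, 0) j) / \<rho> j"
      proof (rule always_eventually, rule allI)
        fix j
        have "\<bar>H j - dist (X j) (x (w, 0) j)\<bar> \<le> dist (f (flat_proj f (X j))) (x (w, 0) j)"
          unfolding H_def by (metis abs_dist_diff_le dist_commute)
        then have "\<bar>H j - dist (X j) (x (w, 0) j)\<bar> / \<rho> j \<le> dist (f (flat_proj f (X j))) (x (w, 0) j) / \<rho> j"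
          using \<rho>(1)[of j] by (simp add: divide_right_mono)
        then show "\<bar>H j / \<rho> j - dist (X j) (x (w, 0) j) / \<rho> j\<bar>
          \<le> dist (f (flat_proj f (X j))) (x (w, 0) j) / \<rho> j"
          using \<rho>(1)[of j] by (simp add: diff_divide_distrib[symmetric])
      qed
    qed simp
    from tendsto_add[OF this xd[OF hs(2)[of u1] hs(1)[of w]]] show ?thesis by (simp add: h_def X_def)
  qed
  have "1 \<le> dist (u1, 1::real) (w, 0::real)"
    by (simp add: dist_Pair_Pair dist_real_def)
  then have "1 / L \<le> dist (u1, 1::real) (w, 0::real) / L" using L(1) by (simp add: divide_right_mono)
  also have "\<dots> \<le> h" unfolding h_def \<Delta>_def by (rule L(2)[OF hs(2) hs(1)])
  finally have hL: "1 / L \<le> h" .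
  have hpos: "h > 0" using hL L(1) by (meson less_le_trans zero_less_divide_1_iff)
  have H_big: "\<forall>\<^sub>F j in \<omega>. D \<le> H j"
  proof -
    have "filterlim (\<lambda>j. H j / \<rho> j * \<rho> j) at_top \<omega>"
      by (rule filterlim_tendsto_pos_mult_at_top[OF h hpos \<rho>(2)])
    moreover have "H j / \<rho> j * \<rho> j = H j" for j using \<rho>(1)[of j] by simp
    ultimately show ?thesis by (simp add: filterlim_at_top)
  qed
  define e where "e j = (SOME e. norm e = 1 \<and> (\<forall>t\<ge>R. H j + c * t \<le> dist (X j) (f (flat_proj f (X j) + t *\<^sub>R e))))" for j
  have e: "\<forall>\<^sub>F j in \<omega>. norm (e j) = 1 \<and> (\<forall>t\<ge>R. H j + c * t \<le> dist (X j) (f (flat_proj f (X j) + t *\<^sub>R e j)))"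
    using H_big
  proof (rule eventually_mono)
    fix j assume "D \<le> H j"
    then have "\<exists>e. norm e = 1 \<and> (\<forall>t\<ge>R. H j + c * t \<le> dist (X j) (f (flat_proj f (X j) + t *\<^sub>R e)))"
      unfolding H_def by (rule steep)
    then show "norm (e j) = 1 \<and> (\<forall>t\<ge>R. H j + c * t \<le> dist (X j) (f (flat_proj f (X j) + t *\<^sub>R e j)))"
      unfolding e_def by (rule someI_ex)
  qed
  have "\<forall>\<^sub>F j in \<omega>. e j \<in> sphere 0 1" using e by (rule eventually_mono) simp
  from nonprincipal_ultrafilter_compact_limit[OF \<omega> compact_sphere this]
  obtain e' where e': "norm e' = 1" "(e \<longlongrightarrow> e') \<omega>" by auto
  \<comment> \<open>A point of the steep ray that is still in the image of the small ball.\<close>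
  have "p + \<delta> *\<^sub>R e' \<in> cball p \<delta>" using p(1) e'(1) by (simp add: dist_norm)
  then have "p + \<delta> *\<^sub>R e' \<in> g ` cball u r" using p(2) by (rule rev_subsetD)
  then obtain u2 where u2: "u2 \<in> cball u r" "g u2 = p + \<delta> *\<^sub>R e'" by (metis imageE)
  have "c * h \<le> \<Delta> (u1, 1) (u2, 1)"
  proof (rule steep_direction_gap[OF cat f ne \<rho> _ _ p(1) _ _ xd[OF hs(2) hs(2)] e'(2,1) c])
    show "((\<lambda>j. flat_proj f (x (u1, 1) j) /\<^sub>R \<rho> j) \<longlongrightarrow> p) \<omega>"
      using P[OF hs(2)[of u1]] u1(2) by (simp add: g_def)
    show "((\<lambda>j. flat_proj f (x (u2, 1) j) /\<^sub>R \<rho> j) \<longlongrightarrow> p + \<delta> *\<^sub>R e') \<omega>"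
      using P[OF hs(2)[of u2]] u2(2) by (simp add: g_def)
    show "((\<lambda>j. dist (x (u1, 1) j) (f (flat_proj f (x (u1, 1) j))) / \<rho> j) \<longlongrightarrow> h) \<omega>"
      using h by (simp add: H_def X_def)
    show "0 \<le> h" using hpos by simp
    show "\<forall>\<^sub>F j in \<omega>. \<forall>t\<ge>R. dist (x (u1, 1) j) (f (flat_proj f (x (u1, 1) j))) + c * t
        \<le> dist (x (u1, 1) j) (f (flat_proj f (x (u1, 1) j) + t *\<^sub>R e j))"
      using e by (rule eventually_mono) (simp add: H_def X_def)
  qed
  also have "\<dots> \<le> L * dist u1 u2" using L(3)[OF hs(2)[of u1] hs(2)[of u2]] by (simp add: \<Delta>_def dP)
  also have "\<dots> \<le> L * (2 * r)"
    using u1(1) u2(1) L(1) dist_triangle[of u1 u2 u] by (intro mult_left_mono) (auto simp: dist_commute)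
  also have "\<dots> = c * (1 / L) / 2" using L(1) by (simp add: r_def power2_eq_square)
  also have "\<dots> < c * (1 / L)"
  proof -
    have "c * (1 / L) > 0" using c L(1) by simp
    moreover have "s / 2 < s" if "s > 0" for s :: real using that by simp
    ultimately show ?thesis by blast
  qed
  also have "\<dots> \<le> c * h" using hL c by (intro mult_left_mono) auto
  finally show False by simp
qed

theorem theoremC:
  fixes \<gamma> :: "'a::complete_space set"
    and \<omega> :: "nat filter" and \<rho> :: "nat \<Rightarrow> real" and b :: 'a
  assumes "locally compact (UNIV :: 'a set)"
    and "CAT0 TYPE('a)"
    and "nonprincipal_ultrafilter \<omega>"
    and "\<forall>j. \<rho> j > 0"
    and "filterlim \<rho> at_top \<omega>"
    and "flat TYPE('k::finite) \<gamma>"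
    and "\<exists>G. subgroup G isometry_group \<and> acts_cocompactly_on G \<gamma>"
    and "\<exists>\<Phi> :: (real^'k) \<times> real \<Rightarrow> (nat \<Rightarrow> 'a) set.
           bilipschitz_embedding_on half_space (asymptotic_cone \<omega> \<rho> b) (cone_dist \<omega> \<rho>) \<Phi> \<and>
           homeomorphic_map (top_of_set half_space_boundary)
             (subtopology (Metric_space.mtopology (asymptotic_cone \<omega> \<rho> b) (cone_dist \<omega> \<rho>))
               (cone_limit \<omega> \<rho> b \<gamma>)) \<Phi>"
  shows "bounds_half_flat TYPE('k) \<gamma>"
proof -
  note cat = assms(2) and \<omega> = assms(3)
  have \<rho>: "\<And>j. \<rho> j > 0" using assms(4) by blast
  obtain f :: "real^'k \<Rightarrow> 'a" where f: "isometric_embedding_on UNIV f" and \<gamma>: "\<gamma> = range f"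
    using assms(6) unfolding flat_def by blast
  obtain G where G: "subgroup G isometry_group" "acts_cocompactly_on G (range f)"
    using assms(7) \<gamma> by blast
  obtain \<Phi> :: "(real^'k) \<times> real \<Rightarrow> (nat \<Rightarrow> 'a) set" where
    \<Phi>: "bilipschitz_embedding_on half_space (asymptotic_cone \<omega> \<rho> b) (cone_dist \<omega> \<rho>) \<Phi>" and
    hom: "homeomorphic_map (top_of_set half_space_boundary)
             (subtopology (Metric_space.mtopology (asymptotic_cone \<omega> \<rho> b) (cone_dist \<omega> \<rho>))
               (cone_limit \<omega> \<rho> b \<gamma>)) \<Phi>"
    using assms(8) by blast
  have bd: "\<Phi> ` half_space_boundary = cone_limit \<omega> \<rho> b (range f)"
  proof -
    interpret Metric_space "asymptotic_cone \<omega> \<rho> b" "cone_dist \<omega> \<rho>"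
      by (rule Metric_space_cone[where \<rho> = \<rho>, OF \<omega> \<rho>])
    show ?thesis
      using homeomorphic_imp_surjective_map[OF hom] by (auto simp: \<gamma> cone_limit_def)
  qed
  have "bounds_half_flat TYPE('k) (range f)"
  proof (rule half_flat_of_flat_horizons[OF cat locally_compact_CAT0_proper[OF assms(1) cat] \<omega> f G], rule ccontr)
    fix R \<epsilon> D :: real
    assume \<epsilon>: "\<epsilon> > 0" and none: "\<nexists>x. D \<le> dist x (f (flat_proj f x)) \<and>
      (\<forall>v. dist (flat_proj f x) v \<le> R \<longrightarrow> dist x (f v) \<le> dist x (f (flat_proj f x)) + \<epsilon>)"
    show False
    proof (rule no_cone_half_space_if_steep[OF cat f \<omega> \<rho> assms(5) \<Phi> bd])
      show "\<epsilon> / max R 1 > 0" using \<epsilon> by simp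
      fix x assume "D \<le> dist x (f (flat_proj f x))"
      then obtain v where v: "dist (flat_proj f x) v \<le> R" "dist x (f (flat_proj f x)) + \<epsilon> < dist x (f v)"
        by (meson none not_le)
      from v(1) have "dist (flat_proj f x) v \<le> max R 1" by simp
      then show "\<exists>e. norm e = 1 \<and> (\<forall>t\<ge>max R 1. dist x (f (flat_proj f x)) + \<epsilon> / max R 1 * t
          \<le> dist x (f (flat_proj f x + t *\<^sub>R e)))"
        using v(2) by (rule steep_direction[OF cat f \<epsilon>])
    qed
  qed
  then show ?thesis by (simp add: \<gamma>)
qed

end
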